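(* Let $K$ be an algebraically closed field with a non-Archimedean valuation, and let $d\ge 0$, $n\ge d+1$ be integers. If $X\in\mathrm{Gr}(d+1,n)$ is a generic linear subspace of $K^n$, with tropicalization $\mathcal{X}$, then $\mathrm{trop}(L(X))=L^{\mathrm{trop}}(\mathcal{X})$ is the Bergman fan of the relabeled Dilworth truncation $\widetilde{\mathrm{D}}_{n-d}(U_{n,n})$.
   Context: $[n]=\{1,\dots,n\}$ and $\binom{[n]}{m}$ is the set of $m$-element subsets of $[n]$. $\mathrm{Gr}(m,n)$ is the Grassmannian of $m$-dimensional subspaces of $K^n$ in its Plücker embedding into $\mathbb{P}^{\binom{n}{m}-1}$. For a $(d+1)$-dimensional subspace $X$, $L(X)\subset\mathrm{Gr}(d,n)\subset\mathbb{P}^{\binom{n}{d}-1}$ is the set of points corresponding to $d$-dimensional subspaces contained in $X$; it is a $d$-dimensional projective linear subspace. Generic: if $X$ is the rowspace of $W\in K^{(d+1)\times n}$, then $L(X)$ is the rowspace of the $(d+1)\times\binom{n}{d}$ matrix $V$ with $V_{i,J}=(-1)^{i+1}\det(W_{-i}^J)$ for $i\in[d+1]$, $J\in\binom{[n]}{d}$ ($W_{-i}^J$: rows $[d+1]\setminus\{i\}$, columns $J$). $X$ is called generic if every maximal minor of $V$ that is not identically zero (as $X$ varies over $\mathrm{Gr}(d+1,n)$) is nonzero for this $X$. Generic subspaces form an open dense subset of $\mathrm{Gr}(d+1,n)$ on which the matroid of $L(X)$ is constant. The notation $L^{\mathrm{trop}}(\mathcal{X})$: the tropicalization of a generic $(d+1)$-dimensional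 subspace is denoted $\mathcal{X}$ (the Bergman fan of the uniform matroid $U_{d+1,n}$), and $L^{\mathrm{trop}}(\mathcal{X})$ denotes the space $\mathrm{trop}(L(X))$ for such generic $X$. Relabeled Dilworth truncation: $\widetilde{\mathrm{D}}_k(U_{n,n})$ is the rank-$(n-k+1)$ matroid on the $(n-k)$-subsets of $[n]$ in which a collection $J_1,\dots,J_m$ is independent iff for every $s>0$ and every $s$-element $\{j_1,\dots,j_s\}\subset[m]$ one has $|\bigcap_{l=1}^sJ_{j_l}|\le n-k+1-s$. (It is the $k$-th Dilworth truncation of the free matroid $U_{n,n}$ on $[n]$, with elements relabeled by their complements.) Tropicalization: for a variety $Y\subset\mathbb{P}^k$, $\mathrm{trop}(Y)=\overline{-\mathrm{val}(Y\cap(K^* )^k)}\subset\mathbb{R}^k\cong\mathbb{R}^{k+1}/\mathbb{R}(1,\dots,1)$, the Euclidean closure of the image under coordinatewise negative valuation of the points of $Y$ in the torus. Bergman fan: for $u\in\mathbb{R}^E$ let $\mathcal F(u)$ be the unique flag $\emptyset=F_0\subsetneq F_1\subsetneq\dots\subsetneq F_m=E$ with $u_i<u_j$ iff there is $k$ with $i\in F_k$, $j\notin F_k$; the Bergman fan of a matroid on $E$ is the set of $u$ (modulo $\mathbb{R}(1,\dots,1)$) such that all members of $\mathcal F(u)$ are flats.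
   Formalization: Two assumptions are added, without which the claim fails: the valuation is nontrivial, and all nonzero maximal minors of V have the same valuation (also required of the X defining L^trop). E.g. x+y+tz=0, val(t)>0, is generic but trop(L(X)) has its vertex off the origin. *)

theory Defs
  imports
    "HOL-Library.Ramsey"
    "HOL-Computational_Algebra.Polynomial"
    "HOL-Analysis.Function_Topology"
    "Jordan_Normal_Form.DL_Submatrix"
    "Jordan_Normal_Form.VS_Connect"
begin

text \<open>The index set \<open>{1,\<dots>,n}\<close> is rendered as \<open>{..<n}\<close>, and the set of its \<open>m\<close>-element
  subsets as \<open>[{..<n}]\<^bsup>m\<^esup>\<close>. A subset of a projective space with coordinates indexed by \<open>E\<close> is
  rendered as a set of nonzero homogeneous coordinate vectors, and a subset of
  \<open>\<real>\<^sup>E\<close> modulo \<open>\<real>(1,\<dots>,1)\<close> as its full preimage in \<open>\<real>\<^sup>E = (E \<rightarrow>\<^sub>E UNIV)\<close>.\<close>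

subsection \<open>Valuations and tropicalization\<close>

text \<open>The value at \<open>0\<close>, which would be \<open>\<infinity>\<close>, is left unspecified and is never used.\<close>

locale nonarch_valuation =
  fixes v :: "'a::field \<Rightarrow> real"
  assumes val_mult: "x \<noteq> 0 \<Longrightarrow> y \<noteq> 0 \<Longrightarrow> v (x * y) = v x + v y"
    and val_add: "x \<noteq> 0 \<Longrightarrow> y \<noteq> 0 \<Longrightarrow> x + y \<noteq> 0 \<Longrightarrow> v (x + y) \<ge> min (v x) (v y)"

text \<open>The parameter \<open>t\<close> makes the set of points closed under adding multiples of
  \<open>(1,\<dots>,1)\<close>.\<close>

definition trop :: "('a::field \<Rightarrow> real) \<Rightarrow> 'i set \<Rightarrow> ('i \<Rightarrow> 'a) set \<Rightarrow> ('i \<Rightarrow> real) set" where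
  "trop v E Y = (powertop_real E) closure_of
     {(\<lambda>i\<in>E. t - v (p i)) | p t. p \<in> Y \<and> (\<forall>i\<in>E. p i \<noteq> 0)}"

subsection \<open>Grassmannians and the linear spaces \<open>L(X)\<close>\<close>

definition Gr :: "nat \<Rightarrow> nat \<Rightarrow> 'a::field vec set set" where
  "Gr m n = {U. VectorSpace.subspace class_ring U (module_vec TYPE('a) n) \<and>
                vectorspace.dim class_ring ((module_vec TYPE('a) n)\<lparr>carrier := U\<rparr>) = m}"

definition pluecker :: "nat \<Rightarrow> nat \<Rightarrow> 'a::field vec set \<Rightarrow> (nat set \<Rightarrow> 'a) set" where
  "pluecker m n U = {(\<lambda>J\<in>[{..<n}]\<^bsup>m\<^esup>. c * det (submatrix A {..<m} J)) | A c.
     A \<in> carrier_mat m n \<and> vec_space.row_space n A = U \<and> c \<noteq> 0}"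

definition L :: "nat \<Rightarrow> nat \<Rightarrow> 'a::field vec set \<Rightarrow> (nat set \<Rightarrow> 'a) set" where
  "L d n X = (\<Union>U\<in>{U \<in> Gr d n. U \<subseteq> X}. pluecker d n U)"

definition trop_L :: "('a::field \<Rightarrow> real) \<Rightarrow> nat \<Rightarrow> nat \<Rightarrow> 'a vec set \<Rightarrow> (nat set \<Rightarrow> real) set" where
  "trop_L v d n X = trop v ([{..<n}]\<^bsup>d\<^esup>) (L d n X)"

definition trop_space :: "('a::field \<Rightarrow> real) \<Rightarrow> nat \<Rightarrow> 'a vec set \<Rightarrow> (nat \<Rightarrow> real) set" where
  "trop_space v n X = trop v {..<n} ((\<lambda>x. \<lambda>i\<in>{..<n}. x $ i) ` (X - {0\<^sub>v n}))"

subsection \<open>Generic subspaces\<close>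

text \<open>Rows are counted from \<open>0\<close>, so the sign \<open>(-1)^(i+1)\<close> for the row index
  \<open>i \<in> {1,\<dots>,d+1}\<close> becomes \<open>(-1)^i\<close>.\<close>

definition V_entry :: "nat \<Rightarrow> 'a::field mat \<Rightarrow> nat \<Rightarrow> nat set \<Rightarrow> 'a" where
  "V_entry d W i J = (-1) ^ i * det (submatrix W ({..<d+1} - {i}) J)"

text \<open>A maximal minor of \<open>V\<close> is indexed by a list of \<open>d + 1\<close> distinct columns; the order of the
  list only affects the sign.\<close>

definition V_columns :: "nat \<Rightarrow> nat \<Rightarrow> nat set list set" where
  "V_columns d n = {Js. length Js = d + 1 \<and> distinct Js \<and> set Js \<subseteq> [{..<n}]\<^bsup>d\<^esup>}"

definition V_minor :: "nat \<Rightarrow> 'a::field mat \<Rightarrow> nat set list \<Rightarrow> 'a" where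
  "V_minor d W Js = det (mat (d+1) (d+1) (\<lambda>(i, l). V_entry d W i (Js ! l)))"

text \<open>Matrices of format \<open>(d+1) \<times> n\<close> whose row space is \<open>X\<close>. Two such matrices differ by an
  invertible factor, so their minors of \<open>V\<close> differ by one common nonzero scalar.\<close>

definition representing :: "nat \<Rightarrow> nat \<Rightarrow> 'a::field vec set \<Rightarrow> 'a mat set" where
  "representing d n X = {W \<in> carrier_mat (d+1) n. vec_space.row_space n W = X}"

definition generic :: "nat \<Rightarrow> nat \<Rightarrow> 'a::field vec set \<Rightarrow> bool" where
  "generic d n X \<longleftrightarrow> X \<in> Gr (d+1) n \<and>
     (\<forall>Js\<in>V_columns d n.
        (\<exists>X'\<in>Gr (d+1) n. \<exists>W'\<in>representing d n (X' :: 'a vec set). V_minor d W' Js \<noteq> 0)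
        \<longrightarrow> (\<forall>W\<in>representing d n X. V_minor d W Js \<noteq> 0))"

text \<open>Over a nontrivially valued field, \<open>trop(L(X))\<close> is the Bergman fan of the matroid of \<open>L(X)\<close>
  only if the nonzero Pluecker coordinates of \<open>L(X)\<close>, i.e. the nonzero maximal minors of \<open>V\<close>, all
  have the same valuation. (For \<open>d = 1\<close>, \<open>n = 3\<close> and the plane \<open>x + y + t z = 0\<close> with \<open>v t > 0\<close>,
  which is generic, it is a tropical line with apex away from the origin.) The condition holds
  for instance if \<open>X\<close> is spanned by vectors over a subfield on which \<open>v\<close> is trivial.\<close>

definition equal_valuations :: "('a::field \<Rightarrow> real) \<Rightarrow> nat \<Rightarrow> nat \<Rightarrow> 'a vec set \<Rightarrow> bool" where
  "equal_valuations v d n X \<longleftrightarrow>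
     (\<forall>W\<in>representing d n X. \<forall>Js\<in>V_columns d n. \<forall>Js'\<in>V_columns d n.
        V_minor d W Js \<noteq> 0 \<longrightarrow> V_minor d W Js' \<noteq> 0 \<longrightarrow> v (V_minor d W Js) = v (V_minor d W Js'))"

text \<open>The common value of \<open>trop(L(X))\<close> for all such generic \<open>X\<close> with tropicalization \<open>\<X>\<close>.\<close>

definition L_trop ::
  "('a::field \<Rightarrow> real) \<Rightarrow> nat \<Rightarrow> nat \<Rightarrow> (nat \<Rightarrow> real) set \<Rightarrow> (nat set \<Rightarrow> real) set" where
  "L_trop v d n \<X> = (THE T. \<exists>X. generic d n X \<and> equal_valuations v d n X \<and>
                              trop_space v n X = \<X> \<and> T = trop_L v d n X)"

subsection \<open>Matroids and Bergman fans\<close>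

text \<open>A matroid is given by its ground set \<open>E\<close>, which is finite, and its independence predicate.\<close>

definition mrank :: "('i set \<Rightarrow> bool) \<Rightarrow> 'i set \<Rightarrow> nat" where
  "mrank indp A = Max (card ` {I. I \<subseteq> A \<and> indp I})"

definition flat :: "'i set \<Rightarrow> ('i set \<Rightarrow> bool) \<Rightarrow> 'i set \<Rightarrow> bool" where
  "flat E indp F \<longleftrightarrow> F \<subseteq> E \<and> (\<forall>e\<in>E - F. mrank indp (insert e F) > mrank indp F)"

text \<open>A flag is rendered as the set of its members; the flag of \<open>u\<close> exists and is unique.\<close>

definition is_flag_of :: "'i set \<Rightarrow> ('i \<Rightarrow> real) \<Rightarrow> 'i set set \<Rightarrow> bool" where
  "is_flag_of E u \<F> \<longleftrightarrow> \<F> \<subseteq> Pow E \<and> {} \<in> \<F> \<and> E \<in> \<F> \<and> (\<forall>F\<in>\<F>. \<forall>G\<in>\<F>. F \<subseteq> G \<or> G \<subseteq> F) \<and>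
     (\<forall>i\<in>E. \<forall>j\<in>E. u i < u j \<longleftrightarrow> (\<exists>F\<in>\<F>. i \<in> F \<and> j \<notin> F))"

definition bergman_fan :: "'i set \<Rightarrow> ('i set \<Rightarrow> bool) \<Rightarrow> ('i \<Rightarrow> real) set" where
  "bergman_fan E indp = {u \<in> E \<rightarrow>\<^sub>E UNIV. \<exists>\<F>. is_flag_of E u \<F> \<and> (\<forall>F\<in>\<F>. flat E indp F)}"

text \<open>The relabeled \<open>k\<close>-th Dilworth truncation of \<open>U\<^sub>n\<^sub>,\<^sub>n\<close>, for \<open>k \<le> n\<close>. The bound
  \<open>n - k + 1 - s\<close> may be negative, hence the term \<open>s = card \<S>\<close> on the left.\<close>

definition dilworth_indep :: "nat \<Rightarrow> nat \<Rightarrow> nat set set \<Rightarrow> bool" where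
  "dilworth_indep n k \<J> \<longleftrightarrow> \<J> \<subseteq> nsets {..<n} (n - k) \<and>
     (\<forall>\<S>\<subseteq>\<J>. \<S> \<noteq> {} \<longrightarrow> card (\<Inter>\<S>) + card \<S> \<le> n - k + 1)"

end

theory Submission
  imports Defs "HOL-Analysis.Elementary_Metric_Spaces" "Jordan_Normal_Form.DL_Rank"
begin

text \<open>Evaluating the columns \<open>V\<^sub>J\<close> of \<open>V\<close> at \<open>y\<close> gives the Pluecker coordinates
  \<open>det [y | W\<^sup>J]\<close> of a \<open>d\<close>-dimensional subspace of \<open>X\<close>, so \<open>L(X)\<close> is the row space of \<open>V\<close>.
  Its matroid is found as follows. If \<open>V\<^sub>J\<close>, \<open>J \<in> \<S>\<close>, are part of a basis, then multiplying by
  \<open>[y | W\<^sup>J]\<close> yields an invertible matrix of size \<open>d + 1\<close> with a zero block of format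
  \<open>card \<S> \<times> card (\<Inter>\<S>)\<close>. Conversely the inequalities \<open>card (\<Inter>\<S>) + card \<S> \<le> d + 1\<close> are
  Hall's condition for a matrix \<open>W\<close>, whose \<open>i\<close>-th row vanishes on the \<open>i\<close>-th set \<open>J\<close>, to have all its
  maximal minors nonzero for suitable entries; then \<open>V\<^sub>J\<close> is a multiple of the \<open>i\<close>-th unit vector.

  For the tropicalization, Cramer's rule writes each coordinate as a combination of the coordinates
  in a basis with coefficients of value \<open>0\<close>. Lower level sets of a point are therefore flats.
  Given a point \<open>u\<close> of the Bergman fan, prescribe the coordinates in a basis of minimal weight with
  pairwise distinct values close to \<open>-u\<close>: then no cancellation occurs, and the other values are close
  to \<open>-u\<close> as well.\<close>

subsection \<open>Valuations and Bergman fans\<close>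

context nonarch_valuation begin

lemma val_one: "v 1 = 0"
  using val_mult[of 1 1] by simp

lemma val_minus: "v (- x) = v x"
proof (cases "x = 0")
  case False
  have "v (- 1) + v (- 1) = 0"
    using val_mult[of "- 1" "- 1"] val_one by simp
  then show ?thesis
    using val_mult[of "- 1" x] False by simp
qed simp

lemma val_divide: "x \<noteq> 0 \<Longrightarrow> y \<noteq> 0 \<Longrightarrow> v (x / y) = v x - v y"
  using val_mult[of "x / y" y] by simp

lemma val_power: "x \<noteq> 0 \<Longrightarrow> v (x ^ k) = real k * v x"
  by (induction k) (auto simp: val_one val_mult algebra_simps)

text \<open>The ultrametric inequality for several summands. The real number \<open>v 0\<close>
  carries no information, so zero summands and zero partial sums are treated apart.\<close>

lemma val_sum_gt:
  assumes "\<And>a. a \<in> A \<Longrightarrow> g a \<noteq> 0 \<Longrightarrow> v (g a) > c" and "sum g A \<noteq> 0"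
  shows "v (sum g A) > c"
  using assms
proof (induction A rule: infinite_finite_induct)
  case (insert a A)
  show ?case
  proof (cases "g a = 0 \<or> sum g A = 0")
    case True
    then show ?thesis using insert by auto
  next
    case False
    then have "v (g a) > c" "v (sum g A) > c" using insert by auto
    then show ?thesis using val_add[of "g a" "sum g A"] False insert by fastforce
  qed
qed auto

text \<open>Write the sum as \<open>g a + r\<close>, where \<open>r\<close> is zero or has larger
  value than \<open>g a\<close>. The ultrametric inequality for this sum and for
  \<open>g a = sum g A - r\<close> gives the two bounds.\<close>

lemma val_sum_dominant:
  assumes "finite A" "a \<in> A" "g a \<noteq> 0"
    and "\<And>b. b \<in> A \<Longrightarrow> b \<noteq> a \<Longrightarrow> g b \<noteq> 0 \<Longrightarrow> v (g b) > v (g a)"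
  shows "sum g A \<noteq> 0" and "v (sum g A) = v (g a)"
proof -
  define r where "r = sum g (A - {a})"
  have s: "sum g A = g a + r" unfolding r_def by (rule sum.remove) (use assms in auto)
  have r: "v r > v (g a)" if "r \<noteq> 0"
    using that unfolding r_def by (intro val_sum_gt) (use assms in auto)
  have "sum g A \<noteq> 0 \<and> v (sum g A) = v (g a)"
  proof (cases "r = 0")
    case False
    have ne: "sum g A \<noteq> 0"
    proof
      assume "sum g A = 0"
      then have "r = - g a" using s by (simp add: eq_neg_iff_add_eq_0 add.commute)
      then show False using r False val_minus by auto
    qed
    have "v (g a) \<ge> min (v (sum g A)) (v r)"
      using val_add[of "sum g A" "- r"] ne False s assms val_minus by simp
    moreover have "v (sum g A) \<ge> min (v (g a)) (v r)"
      using val_add[of "g a" r] ne False s assms by simp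
    ultimately show ?thesis using r[OF False] ne by auto
  qed (use s assms in auto)
  then show "sum g A \<noteq> 0" and "v (sum g A) = v (g a)" by auto
qed

text \<open>Distinct values make the summand of least value unique, and a unique least summand
  cannot be cancelled.\<close>

lemma val_sum_inj:
  assumes "finite A" "A \<noteq> {}" "\<And>a. a \<in> A \<Longrightarrow> g a \<noteq> 0" "inj_on (\<lambda>a. v (g a)) A"
  shows "sum g A \<noteq> 0" and "\<exists>a\<in>A. v (sum g A) = v (g a) \<and> (\<forall>b\<in>A. v (g a) \<le> v (g b))"
proof -
  have "Min ((\<lambda>a. v (g a)) ` A) \<in> (\<lambda>a. v (g a)) ` A" using assms(1,2) by (intro Min_in) auto
  then obtain a where "a \<in> A" "v (g a) = Min ((\<lambda>a. v (g a)) ` A)" by auto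
  then have a: "a \<in> A" "\<And>b. b \<in> A \<Longrightarrow> v (g a) \<le> v (g b)" using assms(1) by auto
  have "v (g b) > v (g a)" if "b \<in> A" "b \<noteq> a" for b
    using a that inj_onD[OF assms(4), of a b] by fastforce
  then have "sum g A \<noteq> 0 \<and> v (sum g A) = v (g a)"
    using val_sum_dominant[of A a g] assms(1,3) a(1) by blast
  then show "sum g A \<noteq> 0" and "\<exists>a\<in>A. v (sum g A) = v (g a) \<and> (\<forall>b\<in>A. v (g a) \<le> v (g b))"
    using a by auto
qed

end

text \<open>An \<open>N\<close>-th root of \<open>t\<close> has value \<open>v t / N\<close>, which
  is nonzero and arbitrarily small for large \<open>N\<close>. The values of its integer powers then
  form a grid finer than \<open>\<epsilon>\<close>.\<close>

lemma alg_closed_value_group_dense: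
  fixes v :: "'a::alg_closed_field \<Rightarrow> real"
  assumes "nonarch_valuation v" and nontriv: "t \<noteq> 0" "v t \<noteq> 0" and "\<epsilon> > 0"
  shows "\<exists>x. x \<noteq> 0 \<and> \<bar>v x - r\<bar> < \<epsilon>"
proof -
  interpret nonarch_valuation v by fact
  obtain N where N: "real N > \<bar>v t\<bar> / \<epsilon>" using reals_Archimedean2 by blast
  then have "real N > 0" using \<open>\<epsilon> > 0\<close> by (smt (verit) divide_nonneg_pos)
  then have "N > 0" by simp
  obtain y where y: "y ^ N = t" using nth_root_exists[OF \<open>N > 0\<close>] by blast
  then have "y \<noteq> 0" using nontriv \<open>N > 0\<close> by (auto simp: power_0_left)
  define s where "s = v y"
  have s: "real N * s = v t" using val_power[OF \<open>y \<noteq> 0\<close>, of N] y s_def by simp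
  then have "s \<noteq> 0" using nontriv by auto
  have "real N * \<bar>s\<bar> = \<bar>v t\<bar>" using s by (metis abs_mult abs_of_nat)
  moreover have "\<bar>v t\<bar> < real N * \<epsilon>" using N \<open>\<epsilon> > 0\<close> by (simp add: pos_divide_less_eq)
  ultimately have s_small: "\<bar>s\<bar> < \<epsilon>"
    using \<open>N > 0\<close> by (metis mult_less_cancel_left_pos of_nat_0_less_iff)
  \<comment> \<open>The grid point \<open>k * s\<close> differs from \<open>r\<close> by less than
    the absolute value of \<open>s\<close>.\<close>
  define k where "k = \<lfloor>r / s\<rfloor>"
  have powi: "v (y powi j) = of_int j * s" for j
  proof (cases "j \<ge> 0")
    case True
    then show ?thesis using val_power[OF \<open>y \<noteq> 0\<close>, of "nat j"]
      by (simp add: power_int_def s_def)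
  next
    case False
    have "v (inverse y) = - s"
      using val_divide[of 1 y] \<open>y \<noteq> 0\<close> val_one by (simp add: s_def inverse_eq_divide)
    then show ?thesis using val_power[of "inverse y" "nat (- j)"] False \<open>y \<noteq> 0\<close>
      by (simp add: power_int_def)
  qed
  have "\<bar>of_int k - r / s\<bar> < 1" unfolding k_def by linarith
  then have "\<bar>of_int k - r / s\<bar> * \<bar>s\<bar> < 1 * \<bar>s\<bar>"
    using \<open>s \<noteq> 0\<close> by (intro mult_strict_right_mono) auto
  moreover have "\<bar>of_int k - r / s\<bar> * \<bar>s\<bar> = \<bar>of_int k * s - r\<bar>"
    using \<open>s \<noteq> 0\<close> by (simp add: abs_mult[symmetric] field_simps)
  ultimately have "\<bar>v (y powi k) - r\<bar> < \<epsilon>" using s_small powi by simp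
  then show ?thesis using \<open>y \<noteq> 0\<close> by (intro exI[of _ "y powi k"]) simp
qed

text \<open>The elements are chosen one after another. A new value has to avoid finitely many old
  ones inside an open interval; what remains is open and nonempty, so density provides an
  element.\<close>

lemma perturbed_valuations:
  fixes v :: "'a::zero \<Rightarrow> real"
  assumes dense: "\<And>r \<epsilon>. \<epsilon> > 0 \<Longrightarrow> \<exists>x. x \<noteq> 0 \<and> \<bar>v x - r\<bar> < \<epsilon>"
    and "\<epsilon> > 0" "finite B"
  shows "\<exists>p. (\<forall>b\<in>B. p b \<noteq> 0 \<and> \<bar>v (p b) - r b\<bar> < \<epsilon>) \<and> inj_on (\<lambda>b. v (p b)) B"
  using \<open>finite B\<close>
proof induction
  case (insert b B)
  then obtain p where p: "\<forall>b\<in>B. p b \<noteq> 0 \<and> \<bar>v (p b) - r b\<bar> < \<epsilon>" "inj_on (\<lambda>b. v (p b)) B"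
    by auto
  define U where "U = {r b - \<epsilon> <..< r b + \<epsilon>} - (\<lambda>b. v (p b)) ` B"
  have "open U" unfolding U_def using insert(1) by (intro open_Diff finite_imp_closed) auto
  moreover have "infinite U" unfolding U_def using insert(1) assms by (intro Diff_infinite_finite) auto
  then obtain s where "s \<in> U" by fastforce
  ultimately obtain \<delta> where \<delta>: "\<delta> > 0" "\<And>s'. dist s' s < \<delta> \<Longrightarrow> s' \<in> U"
    unfolding open_dist by blast
  obtain x where x: "x \<noteq> 0" "\<bar>v x - s\<bar> < \<delta>"
    using dense[OF \<delta>(1)] by blast
  then have "v x \<in> U" using \<delta>(2)[of "v x"] by (simp add: dist_real_def)
  then have near: "\<bar>v x - r b\<bar> < \<epsilon>" and new: "v x \<notin> (\<lambda>b. v (p b)) ` B"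
    unfolding U_def by auto
  have "inj_on (\<lambda>c. v ((p(b := x)) c)) (insert b B)"
  proof (rule inj_onI)
    fix c c' assume "c \<in> insert b B" "c' \<in> insert b B" "v ((p(b := x)) c) = v ((p(b := x)) c')"
    then show "c = c'" using new inj_onD[OF p(2), of c c'] insert(2)
      by (cases "c = b"; cases "c' = b") (simp_all add: image_iff, metis+)
  qed
  moreover have "\<forall>c\<in>insert b B. (p(b := x)) c \<noteq> 0 \<and> \<bar>v ((p(b := x)) c) - r c\<bar> < \<epsilon>"
    using p(1) x(1) near by simp
  ultimately show ?case by blast
qed auto

text \<open>For finite \<open>E\<close>, boxes of one common radius form a neighbourhood base at
  each point of the product, so closure can be tested in the maximum norm.\<close>

lemma closure_of_powertop_real:
  assumes "finite E" "S \<subseteq> E \<rightarrow>\<^sub>E UNIV"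
  shows "powertop_real E closure_of S =
    {u \<in> E \<rightarrow>\<^sub>E UNIV. \<forall>\<epsilon>>0. \<exists>w\<in>S. \<forall>e\<in>E. \<bar>w e - u e\<bar> < \<epsilon>}" (is "?L = ?R")
proof (intro equalityI subsetI)
  fix u assume u: "u \<in> ?L"
  then have "u \<in> E \<rightarrow>\<^sub>E UNIV"
    using closure_of_subset_topspace by (fastforce simp: topspace_product_topology)
  moreover have "\<exists>w\<in>S. \<forall>e\<in>E. \<bar>w e - u e\<bar> < \<epsilon>" if "\<epsilon> > 0" for \<epsilon>
  proof -
    have "openin (powertop_real E) (\<Pi>\<^sub>E e\<in>E. ball (u e) \<epsilon>)"
      using \<open>finite E\<close> by (subst openin_PiE) auto
    moreover have "u \<in> (\<Pi>\<^sub>E e\<in>E. ball (u e) \<epsilon>)"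
      using \<open>u \<in> E \<rightarrow>\<^sub>E UNIV\<close> that by (auto simp: PiE_def)
    ultimately obtain w where "w \<in> S" "w \<in> (\<Pi>\<^sub>E e\<in>E. ball (u e) \<epsilon>)"
      using u unfolding in_closure_of by blast
    then show ?thesis by (intro bexI[of _ w]) (auto simp: PiE_iff dist_real_def abs_minus_commute)
  qed
  ultimately show "u \<in> ?R" by auto
next
  fix u assume u: "u \<in> ?R"
  have "\<exists>w. w \<in> S \<and> w \<in> T" if T: "u \<in> T" "openin (powertop_real E) T" for T
  proof -
    obtain U where U: "\<forall>e\<in>E. open (U e)" "u \<in> Pi\<^sub>E E U" "Pi\<^sub>E E U \<subseteq> T"
      using T unfolding openin_product_topology_alt by auto
    have "\<exists>\<delta>>0. ball (u e) \<delta> \<subseteq> U e" if "e \<in> E" for e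
      using U that open_contains_ball[of "U e"] by (auto simp: PiE_iff)
    then obtain \<delta> where \<delta>: "\<And>e. e \<in> E \<Longrightarrow> \<delta> e > 0 \<and> ball (u e) (\<delta> e) \<subseteq> U e" by metis
    \<comment> \<open>The \<open>1\<close> keeps the minimum meaningful and positive when
      \<open>E\<close> is empty.\<close>
    define \<epsilon> where "\<epsilon> = Min (insert 1 (\<delta> ` E))"
    have "\<epsilon> > 0" unfolding \<epsilon>_def using \<open>finite E\<close> \<delta> by auto
    then obtain w where w: "w \<in> S" "\<forall>e\<in>E. \<bar>w e - u e\<bar> < \<epsilon>" using u by auto
    have "w e \<in> U e" if "e \<in> E" for e
    proof -
      have "\<epsilon> \<le> \<delta> e" unfolding \<epsilon>_def using \<open>finite E\<close> that by simp
      then have "w e \<in> ball (u e) (\<delta> e)"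
        using w(2)[rule_format, OF that] by (simp add: dist_real_def abs_minus_commute)
      then show ?thesis using \<delta> that by blast
    qed
    then have "w \<in> Pi\<^sub>E E U" using w(1) assms(2) by (auto simp: PiE_iff)
    then show ?thesis using U w by auto
  qed
  then show "u \<in> ?L" using u unfolding in_closure_of by (auto simp: topspace_product_topology)
qed

text \<open>Each lower level set is a member of any flag of \<open>u\<close>, and conversely the
  lower level sets form such a flag. This turns the quantification over flags into a condition on
  level sets.\<close>

lemma bergman_fan_iff:
  assumes "finite E"
  shows "u \<in> bergman_fan E indp \<longleftrightarrow> u \<in> E \<rightarrow>\<^sub>E UNIV \<and> (\<forall>c. flat E indp {e\<in>E. u e \<le> c})"
proof
  assume "u \<in> bergman_fan E indp"
  then obtain \<F> where u: "u \<in> E \<rightarrow>\<^sub>E UNIV" and \<F>: "is_flag_of E u \<F>" "\<forall>F\<in>\<F>. flat E indp F"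
    unfolding bergman_fan_def by auto
  have order: "u i < u j \<longleftrightarrow> (\<exists>F\<in>\<F>. i \<in> F \<and> j \<notin> F)" if "i \<in> E" "j \<in> E" for i j
    using \<F>(1) that unfolding is_flag_of_def by simp
  have "{e\<in>E. u e \<le> c} \<in> \<F>" for c
  proof -
    define A where "A = {e\<in>E. u e \<le> c}"
    have "A \<in> \<F>"
    proof (cases "A = {} \<or> A = E")
      case True
      then show ?thesis using \<F> unfolding is_flag_of_def by auto
    next
      case False
      have AE: "A \<subseteq> E" unfolding A_def by auto
      then have fin: "finite (u ` A)" "finite (u ` (E - A))" using assms finite_subset by auto
      have "Max (u ` A) \<in> u ` A" using fin False by (intro Max_in) auto
      then obtain i where i: "i \<in> A" "u i = Max (u ` A)" by auto
      have "Min (u ` (E - A)) \<in> u ` (E - A)" using fin False AE by (intro Min_in) auto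
      then obtain j where j: "j \<in> E - A" "u j = Min (u ` (E - A))" by auto
      \<comment> \<open>The flag member separating these two extreme elements turns out to be
        \<open>A\<close>: by \<open>sep\<close>, a misplaced element would contradict the
        extremality of \<open>i\<close> or \<open>j\<close>.\<close>
      have "u i < u j" using i j unfolding A_def by auto
      then obtain F where F: "F \<in> \<F>" "i \<in> F" "j \<notin> F"
        using order[of i j] i j AE by blast
      have "F \<subseteq> E" using F \<F>(1) unfolding is_flag_of_def by auto
      have sep: "u x < u y" if "x \<in> F" "y \<in> E - F" for x y
        using order[of x y] F(1) that \<open>F \<subseteq> E\<close> by blast
      have "x \<in> F" if "x \<in> A" for x
      proof (rule ccontr)
        assume "x \<notin> F"
        then have "u i < u x" using sep[of i x] that F AE by blast
        moreover have "u x \<le> u i" using i(2) fin(1) that by simp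
        ultimately show False by simp
      qed
      moreover have "x \<in> A" if "x \<in> F" for x
      proof (rule ccontr)
        assume "x \<notin> A"
        then have "x \<in> E - A" using that \<open>F \<subseteq> E\<close> by blast
        then have "u j \<le> u x" using j(2) fin(2) by simp
        moreover have "u x < u j" using sep[of x j] that F(3) j(1) by blast
        ultimately show False by simp
      qed
      ultimately show ?thesis using F by (metis subsetI subset_antisym)
    qed
    then show ?thesis unfolding A_def .
  qed
  then show "u \<in> E \<rightarrow>\<^sub>E UNIV \<and> (\<forall>c. flat E indp {e\<in>E. u e \<le> c})" using u \<F> by auto
next
  assume u: "u \<in> E \<rightarrow>\<^sub>E UNIV \<and> (\<forall>c. flat E indp {e\<in>E. u e \<le> c})"
  define \<F> where "\<F> = range (\<lambda>c. {e\<in>E. u e \<le> c})"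
  have fin: "finite (u ` E)" using assms by auto
  have "{} \<in> \<F>" unfolding \<F>_def
  proof (rule range_eqI)
    \<comment> \<open>Adding \<open>0\<close> to the values covers the case of an empty
      \<open>E\<close>.\<close>
    have "\<not> u e \<le> Min (insert 0 (u ` E)) - 1" if "e \<in> E" for e
    proof -
      have "Min (insert 0 (u ` E)) \<le> u e" by (rule Min_le) (use fin that in auto)
      then show ?thesis by linarith
    qed
    then show "{} = {e\<in>E. u e \<le> Min (insert 0 (u ` E)) - 1}" by blast
  qed
  moreover have "E \<in> \<F>" unfolding \<F>_def
  proof (rule range_eqI)
    have "u e \<le> Max (insert 0 (u ` E))" if "e \<in> E" for e
      using Max_ge[of "insert 0 (u ` E)" "u e"] fin that by simp
    then show "E = {e\<in>E. u e \<le> Max (insert 0 (u ` E))}" by blast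
  qed
  moreover have "u i < u j \<longleftrightarrow> (\<exists>F\<in>\<F>. i \<in> F \<and> j \<notin> F)" if "i \<in> E" "j \<in> E" for i j
    unfolding \<F>_def using that by (auto intro: exI[of _ "u i"])
  moreover have "\<F> \<subseteq> Pow E" unfolding \<F>_def by auto
  moreover have "F \<subseteq> G \<or> G \<subseteq> F" if "F \<in> \<F>" "G \<in> \<F>" for F G
    using that unfolding \<F>_def by (fastforce intro: order_trans)
  ultimately have "is_flag_of E u \<F>"
    unfolding is_flag_of_def by simp
  moreover have "\<forall>F\<in>\<F>. flat E indp F" using u unfolding \<F>_def by blast
  ultimately show "u \<in> bergman_fan E indp" using u unfolding bergman_fan_def by blast
qed

subsection \<open>Linear spaces over a valued field\<close>

lemma nonsingular_inverse:
  fixes A :: "'a::field mat"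
  assumes "A \<in> carrier_mat m m" "det A \<noteq> 0"
  obtains B where "B \<in> carrier_mat m m" "A * B = 1\<^sub>m m" "B * A = 1\<^sub>m m"
  using det_non_zero_imp_unit[OF assms, unfolded Units_def, of "()"]
  by (auto simp: ring_mat_def)

text \<open>The vectors \<open>f e\<close> are the columns of a matrix with \<open>m\<close> rows.
  Bases are ordered lists of columns, so that exchanging one element is a list update and minors
  keep their signs.\<close>

locale vector_configuration =
  fixes m :: nat and E :: "'e set" and f :: "'e \<Rightarrow> nat \<Rightarrow> 'a::field"
  assumes finite_E: "finite E"
begin

definition minor :: "'e list \<Rightarrow> 'a" where
  "minor Js = det (mat m m (\<lambda>(i, l). f (Js ! l) i))"

definition bases :: "'e list set" where
  "bases = {Js. length Js = m \<and> set Js \<subseteq> E \<and> minor Js \<noteq> 0}"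

text \<open>This is the matroid represented by the columns whenever \<open>bases\<close> is
  nonempty, that is, whenever the columns have full rank \<open>m\<close>.\<close>

definition indep :: "'e set \<Rightarrow> bool" where
  "indep I \<longleftrightarrow> (\<exists>Js\<in>bases. I \<subseteq> set Js)"

text \<open>The coordinate at \<open>e\<close> of the point of the row space with coefficient vector
  \<open>y\<close>.\<close>

definition pairing :: "(nat \<Rightarrow> 'a) \<Rightarrow> 'e \<Rightarrow> 'a" where
  "pairing y e = (\<Sum>i<m. y i * f e i)"

lemma minor_nonzero_distinct:
  assumes "length Js = m" "minor Js \<noteq> 0"
  shows "distinct Js"
proof (rule ccontr)
  assume "\<not> distinct Js"
  then obtain i j where ij: "i < m" "j < m" "i \<noteq> j" "Js ! i = Js ! j"
    using assms(1) by (auto simp: distinct_conv_nth)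
  have "minor Js = 0" unfolding minor_def
    by (rule det_identical_columns[of _ m i j]) (use ij in auto)
  then show False using assms(2) by simp
qed

lemma bases_distinct: "Js \<in> bases \<Longrightarrow> distinct Js"
  using minor_nonzero_distinct unfolding bases_def by auto

lemma bases_length: "Js \<in> bases \<Longrightarrow> length Js = m"
  unfolding bases_def by auto

lemma bases_subset: "Js \<in> bases \<Longrightarrow> set Js \<subseteq> E"
  unfolding bases_def by auto

text \<open>The coefficients of \<open>f e\<close> in a basis are quotients of minors. If all
  nonzero minors have the same value, each nonzero coefficient with \<open>e\<close> in
  \<open>E\<close> therefore has value \<open>0\<close>.\<close>

lemma cramer:
  assumes "Js \<in> bases" "i < m"
  shows "f e i = (\<Sum>l<m. minor (Js[l := e]) / minor Js * f (Js ! l) i)"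
proof -
  define A where "A = mat m m (\<lambda>(i, l). f (Js ! l) i)"
  define b where "b = vec m (f e)"
  have A: "A \<in> carrier_mat m m" and b: "b \<in> carrier_vec m" by (auto simp: A_def b_def)
  have det: "det A = minor Js" "minor Js \<noteq> 0" using assms(1) by (auto simp: A_def minor_def bases_def)
  obtain B where B: "B \<in> carrier_mat m m" "A * B = 1\<^sub>m m"
    using nonsingular_inverse[OF A] det by metis
  define x where "x = B *\<^sub>v b"
  have x: "x \<in> carrier_vec m" using B b by (simp add: x_def)
  have Ax: "A *\<^sub>v x = b"
    unfolding x_def using A B b by (metis assoc_mult_mat_vec one_mult_mat_vec)
  have coord: "minor (Js[l := e]) = x $ l * minor Js" if "l < m" for l
  proof -
    have "replace_col A b l = mat m m (\<lambda>(i, l'). f (Js[l := e] ! l') i)"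
      using that bases_length[OF assms(1)]
      by (intro eq_matI) (auto simp: replace_col_def A_def b_def nth_list_update)
    then show ?thesis using cramer_lemma_mat[OF A x that] det Ax by (simp add: minor_def)
  qed
  have "f e i = (A *\<^sub>v x) $ i" using Ax assms(2) by (simp add: b_def)
  also have "\<dots> = (\<Sum>l<m. f (Js ! l) i * x $ l)"
    using A x assms(2) by (simp add: A_def scalar_prod_def lessThan_atLeast0)
  also have "\<dots> = (\<Sum>l<m. minor (Js[l := e]) / minor Js * f (Js ! l) i)"
    using coord det by (intro sum.cong) (auto simp: field_simps)
  finally show ?thesis .
qed

lemma pairing_cramer:
  assumes "Js \<in> bases"
  shows "pairing y e = (\<Sum>l<m. minor (Js[l := e]) / minor Js * pairing y (Js ! l))"
proof -
  have "pairing y e = (\<Sum>i<m. \<Sum>l<m. y i * (minor (Js[l := e]) / minor Js * f (Js ! l) i))"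
    unfolding pairing_def by (intro sum.cong refl) (simp add: cramer[OF assms, of _ e] sum_distrib_left)
  also have "\<dots> = (\<Sum>l<m. \<Sum>i<m. y i * (minor (Js[l := e]) / minor Js * f (Js ! l) i))"
    by (rule sum.swap)
  also have "\<dots> = (\<Sum>l<m. minor (Js[l := e]) / minor Js * pairing y (Js ! l))"
    unfolding pairing_def by (simp only: sum_distrib_left mult.left_commute)
  finally show ?thesis .
qed

text \<open>Expand along column \<open>l\<close>: the cofactors \<open>C\<close> of that column do
  not involve its entries.\<close>

lemma minor_linear:
  assumes "l < m" "length Js = m" "\<And>i. i < m \<Longrightarrow> f e i = (\<Sum>b\<in>B. c b * f (h b) i)"
  shows "minor (Js[l := e]) = (\<Sum>b\<in>B. c b * minor (Js[l := h b]))"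
proof -
  define C where "C i = cofactor (mat m m (\<lambda>(i, l). f (Js ! l) i)) i l" for i
  have expand: "minor (Js[l := x]) = (\<Sum>i<m. f x i * C i)" for x
  proof -
    define A where "A = mat m m (\<lambda>(i, l'). f (Js[l := x] ! l') i)"
    have "det A = (\<Sum>i<m. A $$ (i, l) * cofactor A i l)"
      by (rule laplace_expansion_column) (use assms in \<open>auto simp: A_def\<close>)
    also have "\<dots> = (\<Sum>i<m. f x i * C i)"
    proof (intro sum.cong refl)
      fix i assume "i \<in> {..<m}"
      moreover have "mat_delete A i l = mat_delete (mat m m (\<lambda>(i, l). f (Js ! l) i)) i l"
        by (intro eq_matI) (auto simp: mat_delete_def A_def)
      ultimately show "A $$ (i, l) * cofactor A i l = f x i * C i"
        using assms(1,2) by (simp add: C_def cofactor_def A_def)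
    qed
    finally show ?thesis by (simp add: minor_def A_def)
  qed
  have "minor (Js[l := e]) = (\<Sum>i<m. \<Sum>b\<in>B. c b * f (h b) i * C i)"
    unfolding expand by (intro sum.cong refl) (simp add: assms(3) sum_distrib_right)
  also have "\<dots> = (\<Sum>b\<in>B. \<Sum>i<m. c b * f (h b) i * C i)" by (rule sum.swap)
  also have "\<dots> = (\<Sum>b\<in>B. c b * minor (Js[l := h b]))"
    unfolding expand by (intro sum.cong refl) (simp add: sum_distrib_left mult.assoc)
  finally show ?thesis .
qed

lemma exchange:
  assumes "Js \<in> bases" "e \<in> E" "l < m" "minor (Js[l := e]) \<noteq> 0"
  shows "Js[l := e] \<in> bases" and "set (Js[l := e]) = insert e (set Js - {Js ! l})"
  using assms set_update_subset_insert[of Js l e]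
    set_update_distinct[OF bases_distinct[OF assms(1)], of l e]
  by (auto simp: bases_def)

section \<open>Rank and flats of a vector configuration\<close>

lemma card_le_mrank: "A \<subseteq> E \<Longrightarrow> I \<subseteq> A \<Longrightarrow> indep I \<Longrightarrow> card I \<le> mrank indep A"
  unfolding mrank_def using finite_subset[OF _ finite_E] by (intro Max_ge) auto

lemma mrank_attained:
  assumes "bases \<noteq> {}" "A \<subseteq> E"
  obtains I where "I \<subseteq> A" "indep I" "card I = mrank indep A"
proof -
  have "mrank indep A \<in> card ` {I. I \<subseteq> A \<and> indep I}"
    unfolding mrank_def
  proof (intro Max_in)
    show "finite (card ` {I. I \<subseteq> A \<and> indep I})"
      using finite_subset[OF assms(2) finite_E] by simp
    have "indep {}" using assms(1) unfolding indep_def by auto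
    then show "card ` {I. I \<subseteq> A \<and> indep I} \<noteq> {}" by blast
  qed
  then show thesis using that by auto
qed

lemma flatI:
  assumes "bases \<noteq> {}" "F \<subseteq> E"
    and "\<And>e I. e \<in> E - F \<Longrightarrow> I \<subseteq> F \<Longrightarrow> indep I \<Longrightarrow> indep (insert e I)"
  shows "flat E indep F"
  unfolding flat_def
proof (intro conjI ballI)
  fix e assume e: "e \<in> E - F"
  obtain I where I: "I \<subseteq> F" "indep I" "card I = mrank indep F"
    using mrank_attained[OF assms(1,2)] by blast
  have "card (insert e I) \<le> mrank indep (insert e F)"
    using assms(3)[OF e I(1,2)] e I assms(2) by (intro card_le_mrank) auto
  moreover have "card (insert e I) = Suc (card I)"
    using e I(1) finite_subset[OF I(1) finite_subset[OF assms(2) finite_E]] by (subst card_insert_disjoint) auto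
  ultimately show "mrank indep F < mrank indep (insert e F)" using I(3) by simp
qed (rule assms(2))

text \<open>If every basis element occurring in the expansion of \<open>e\<close> were in
  \<open>F\<close>, then \<open>e\<close> would lie in the span of \<open>F\<close> and could not
  raise the rank. The proof is an exchange argument in a basis \<open>Ks\<close> containing a
  largest independent subset of \<open>insert e F\<close>.\<close>

lemma flat_not_in_span:
  assumes "flat E indep F" "e \<in> E - F" "Js \<in> bases"
  shows "\<exists>l<m. minor (Js[l := e]) \<noteq> 0 \<and> Js ! l \<notin> F"
proof (rule ccontr)
  assume "\<not> ?thesis"
  then have span: "Js ! l \<in> F" if "l < m" "minor (Js[l := e]) \<noteq> 0" for l using that by blast
  have F: "F \<subseteq> E" using assms(1) unfolding flat_def by auto
  have "insert e F \<subseteq> E" using F assms(2) by auto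
  then obtain I where I: "I \<subseteq> insert e F" "indep I" "card I = mrank indep (insert e F)"
    using mrank_attained assms(3) by blast
  have larger: "mrank indep F < card I" using I(3) assms(1,2) unfolding flat_def by auto
  have "e \<in> I"
  proof (rule ccontr)
    assume "e \<notin> I"
    then have "card I \<le> mrank indep F" using I F by (intro card_le_mrank) auto
    then show False using larger by simp
  qed
  obtain Ks where Ks: "Ks \<in> bases" "I \<subseteq> set Ks" using I(2) unfolding indep_def by auto
  then obtain k where k: "k < m" "Ks ! k = e"
    using \<open>e \<in> I\<close> bases_length by (metis in_set_conv_nth subsetD)
  \<comment> \<open>If \<open>x\<close> could replace \<open>e\<close> in \<open>Ks\<close>, then
    \<open>I\<close> with \<open>e\<close> replaced by \<open>x\<close> would be an independent
    subset of \<open>F\<close> with more elements than the rank of \<open>F\<close>.\<close>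
  have zero: "minor (Ks[k := x]) = 0" if "x \<in> F" for x
  proof (rule ccontr)
    assume nz: "minor (Ks[k := x]) \<noteq> 0"
    have "x \<in> E" using that F by auto
    note ex = exchange[OF Ks(1) \<open>x \<in> E\<close> k(1) nz]
    have "distinct (Ks[k := x])" using bases_distinct ex(1) .
    \<comment> \<open>Otherwise \<open>x\<close> would occupy two positions of the new
      basis.\<close>
    have "x \<notin> I - {e}"
    proof
      assume "x \<in> I - {e}"
      then obtain j where j: "j < m" "Ks ! j = x" "j \<noteq> k"
        using Ks k bases_length by (metis DiffE in_set_conv_nth insertI1 subsetD)
      then have "Ks[k := x] ! j = Ks[k := x] ! k" using k bases_length[OF Ks(1)] by simp
      then show False
        using nth_eq_iff_index_eq[OF \<open>distinct (Ks[k := x])\<close>, of j k] j k bases_length[OF Ks(1)] by simp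
    qed
    have "indep (insert x (I - {e}))" unfolding indep_def
      using ex Ks(2) k by (intro bexI[OF _ ex(1)]) auto
    moreover have "insert x (I - {e}) \<subseteq> F" using I(1) that by auto
    ultimately have "card (insert x (I - {e})) \<le> mrank indep F" using F card_le_mrank by blast
    moreover have "finite I" using finite_subset[OF Ks(2)] by simp
    then have "card (insert x (I - {e})) = card I"
      using \<open>x \<notin> I - {e}\<close> \<open>e \<in> I\<close> by (metis card_Suc_Diff1 card_insert_disjoint finite_Diff)
    ultimately show False using larger by simp
  qed
  \<comment> \<open>Linearity in column \<open>k\<close> writes \<open>minor Ks\<close> as a
    combination of minors that vanish by \<open>zero\<close>, although \<open>Ks\<close> is a
    basis.\<close>
  have "minor (Ks[k := e]) = (\<Sum>l<m. minor (Js[l := e]) / minor Js * minor (Ks[k := Js ! l]))"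
    by (rule minor_linear[OF k(1) bases_length[OF Ks(1)] cramer[OF assms(3)]])
  also have "\<dots> = 0"
  proof (intro sum.neutral ballI)
    fix l assume "l \<in> {..<m}"
    then show "minor (Js[l := e]) / minor Js * minor (Ks[k := Js ! l]) = 0"
      using zero[of "Js ! l"] span[of l] by (cases "minor (Js[l := e]) = 0") auto
  qed
  finally have "minor Ks = 0" using k by (metis list_update_id)
  then show False using Ks(1) unfolding bases_def by simp
qed

text \<open>The coefficients \<open>y\<close> solve a linear system whose matrix is the transpose of
  an invertible one, so the coordinates in a basis are free parameters.\<close>

lemma pairing_prescribed:
  assumes "Js \<in> bases"
  shows "\<exists>y. \<forall>l<m. pairing y (Js ! l) = p (Js ! l)"
proof -
  define A where "A = mat m m (\<lambda>(i, l). f (Js ! l) i)"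
  have A: "A \<in> carrier_mat m m" by (auto simp: A_def)
  have det: "det A \<noteq> 0" using assms by (auto simp: A_def minor_def bases_def)
  obtain B where B: "B \<in> carrier_mat m m" "B * A = 1\<^sub>m m"
    using nonsingular_inverse[OF A det] by metis
  define q where "q = vec m (\<lambda>l. p (Js ! l))"
  define y where "y = B\<^sup>T *\<^sub>v q"
  have q: "q \<in> carrier_vec m" by (simp add: q_def)
  have y: "y \<in> carrier_vec m" using B by (simp add: y_def q_def)
  have "A\<^sup>T *\<^sub>v y = (A\<^sup>T * B\<^sup>T) *\<^sub>v q" unfolding y_def using A B q by simp
  also have "A\<^sup>T * B\<^sup>T = 1\<^sub>m m" using A B by (metis transpose_mult transpose_one)
  finally have Ay: "A\<^sup>T *\<^sub>v y = q" using q by simp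
  have "pairing (\<lambda>i. y $ i) (Js ! l) = p (Js ! l)" if "l < m" for l
  proof -
    have "p (Js ! l) = (A\<^sup>T *\<^sub>v y) $ l" using Ay that by (simp add: q_def)
    also have "\<dots> = pairing (\<lambda>i. y $ i) (Js ! l)"
      using y that by (auto simp: A_def pairing_def scalar_prod_def lessThan_atLeast0 mult.commute intro!: sum.cong)
    finally show ?thesis by simp
  qed
  then show ?thesis by blast
qed

text \<open>\<open>F\<close> is a lower level set of the negative values. If an independent
  \<open>I\<close> in \<open>F\<close> could not be enlarged by \<open>e\<close>, Cramer's rule
  would write the coordinate at \<open>e\<close> as a sum of coordinates in \<open>F\<close> with
  coefficients of value \<open>0\<close>, hence of terms that all have too large a value.\<close>

lemma valuation_gap_flat:
  assumes "nonarch_valuation v" "bases \<noteq> {}"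
    and equal: "\<And>Js Ks. Js \<in> bases \<Longrightarrow> Ks \<in> bases \<Longrightarrow> v (minor Js) = v (minor Ks)"
    and nz: "\<And>e. e \<in> E \<Longrightarrow> pairing y e \<noteq> 0"
    and "F \<subseteq> E" and gap: "\<And>x e. x \<in> F \<Longrightarrow> e \<in> E - F \<Longrightarrow> v (pairing y x) > v (pairing y e)"
  shows "flat E indep F"
proof (rule flatI[OF assms(2) \<open>F \<subseteq> E\<close>])
  interpret nonarch_valuation v by fact
  fix e I assume e: "e \<in> E - F" and I: "I \<subseteq> F" "indep I"
  obtain Js where Js: "Js \<in> bases" "I \<subseteq> set Js" using I(2) unfolding indep_def by auto
  \<comment> \<open>Such an \<open>l\<close> allows \<open>e\<close> to enter the basis in place of
    \<open>Js ! l\<close> without disturbing \<open>I\<close>.\<close>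
  have "\<exists>l<m. minor (Js[l := e]) \<noteq> 0 \<and> Js ! l \<notin> I"
  proof (rule ccontr)
    assume none: "\<not> (\<exists>l<m. minor (Js[l := e]) \<noteq> 0 \<and> Js ! l \<notin> I)"
    have big: "v (minor (Js[l := e]) / minor Js * pairing y (Js ! l)) > v (pairing y e)"
      if l: "l < m" "minor (Js[l := e]) \<noteq> 0" for l
    proof -
      have inF: "Js ! l \<in> F" using l none I(1) by blast
      then have "Js ! l \<in> E" using \<open>F \<subseteq> E\<close> by blast
      have "minor Js \<noteq> 0" using Js(1) by (simp add: bases_def)
      moreover have "Js[l := e] \<in> bases" using exchange(1)[OF Js(1) _ l] e by blast
      ultimately have "v (minor (Js[l := e]) / minor Js) = 0"
        using val_divide[OF l(2)] equal[OF _ Js(1)] by simp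
      moreover have "minor (Js[l := e]) / minor Js \<noteq> 0" using l(2) \<open>minor Js \<noteq> 0\<close> by simp
      ultimately have "v (minor (Js[l := e]) / minor Js * pairing y (Js ! l)) = v (pairing y (Js ! l))"
        using val_mult[OF \<open>minor (Js[l := e]) / minor Js \<noteq> 0\<close> nz[OF \<open>Js ! l \<in> E\<close>]] by linarith
      then show ?thesis using gap[OF inF e] by simp
    qed
    have "v (\<Sum>l<m. minor (Js[l := e]) / minor Js * pairing y (Js ! l)) > v (pairing y e)"
    proof (intro val_sum_gt)
      show "(\<Sum>l<m. minor (Js[l := e]) / minor Js * pairing y (Js ! l)) \<noteq> 0"
        using nz[of e] e pairing_cramer[OF Js(1), of y e] by simp
    qed (use big in auto)
    then show False using pairing_cramer[OF Js(1), of y e] by simp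
  qed
  then obtain l where l: "l < m" "minor (Js[l := e]) \<noteq> 0" "Js ! l \<notin> I" by blast
  have "e \<in> E" using e by simp
  note ex = exchange[OF Js(1) \<open>e \<in> E\<close> l(1,2)]
  show "indep (insert e I)" unfolding indep_def using ex(2) Js(2) l(3) by (intro bexI[OF _ ex(1)]) auto
qed

end

section \<open>Valuations of the points of a linear space\<close>

context vector_configuration begin

text \<open>A limit point inherits flatness because each of its level sets is also cut off by a gap
  in every sufficiently close point of the set. Conversely \<open>u\<close> is approximated by the
  point whose coordinates in a basis of least weight have perturbed values near
  \<open>-u\<close>.\<close>

theorem closure_eq_bergman_fan:
  fixes v :: "'a \<Rightarrow> real"
  assumes "nonarch_valuation v" "bases \<noteq> {}"
    and dense: "\<And>r \<epsilon>. \<epsilon> > 0 \<Longrightarrow> \<exists>x. x \<noteq> 0 \<and> \<bar>v x - r\<bar> < \<epsilon>"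
    and equal: "\<And>Js Ks. Js \<in> bases \<Longrightarrow> Ks \<in> bases \<Longrightarrow> v (minor Js) = v (minor Ks)"
  shows "powertop_real E closure_of {(\<lambda>e\<in>E. t - v (pairing y e)) | y t. \<forall>e\<in>E. pairing y e \<noteq> 0}
    = bergman_fan E indep" (is "_ closure_of ?S = _")
proof -
  interpret nonarch_valuation v by fact
  have "?S \<subseteq> E \<rightarrow>\<^sub>E UNIV" by auto
  note closure = closure_of_powertop_real[OF finite_E this]
  show ?thesis
  proof (intro equalityI subsetI)
    fix u assume "u \<in> powertop_real E closure_of ?S"
    then have u: "u \<in> E \<rightarrow>\<^sub>E UNIV" "\<And>\<epsilon>. \<epsilon> > 0 \<Longrightarrow> \<exists>w\<in>?S. \<forall>e\<in>E. \<bar>w e - u e\<bar> < \<epsilon>"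
      unfolding closure by auto
    have "flat E indep {e\<in>E. u e \<le> c}" for c
    proof -
      \<comment> \<open>\<open>\<delta>\<close> will be at most a third of every gap above level
        \<open>c\<close>, so the order across this level survives an error below
        \<open>\<delta>\<close> at both ends.\<close>
      define gaps where "gaps = (\<lambda>e. (u e - c) / 3) ` {e\<in>E. u e > c}"
      define \<delta> where "\<delta> = Min (insert 1 gaps)"
      have gaps: "finite gaps" "\<And>g. g \<in> gaps \<Longrightarrow> g > 0"
        unfolding gaps_def using finite_E by auto
      then have "\<delta> > 0" unfolding \<delta>_def by simp
      have above: "u e > c + 2 * \<delta>" if "e \<in> E" "u e > c" for e
      proof -
        have "\<delta> \<le> (u e - c) / 3" unfolding \<delta>_def
          using gaps(1) that by (intro Min_le) (auto simp: gaps_def)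
        then show ?thesis using \<open>\<delta> > 0\<close> by simp
      qed
      obtain w where w: "w \<in> ?S" "\<And>e. e \<in> E \<Longrightarrow> \<bar>w e - u e\<bar> < \<delta>"
        using u(2)[OF \<open>\<delta> > 0\<close>] by blast
      then obtain y t where y: "w = (\<lambda>e\<in>E. t - v (pairing y e))" "\<And>e. e \<in> E \<Longrightarrow> pairing y e \<noteq> 0"
        by blast
      show ?thesis
      proof (rule valuation_gap_flat[OF assms(1,2) equal y(2)])
        fix x e assume "x \<in> {e\<in>E. u e \<le> c}" "e \<in> E - {e\<in>E. u e \<le> c}"
        then have *: "x \<in> E" "u x \<le> c" "e \<in> E" "u e > c" by auto
        have "\<bar>t - v (pairing y x) - u x\<bar> < \<delta>" "\<bar>t - v (pairing y e) - u e\<bar> < \<delta>"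
          using w(2)[OF *(1)] w(2)[OF *(3)] *(1,3) by (auto simp: y(1))
        then show "v (pairing y e) < v (pairing y x)" using above[OF *(3,4)] *(2) by linarith
      qed auto
    qed
    then show "u \<in> bergman_fan E indep" using u(1) bergman_fan_iff[OF finite_E] by blast
  next
    fix u assume "u \<in> bergman_fan E indep"
    then have u: "u \<in> E \<rightarrow>\<^sub>E UNIV" "\<And>c. flat E indep {e\<in>E. u e \<le> c}"
      using bergman_fan_iff[OF finite_E] by blast+
    define weight where "weight Js = (\<Sum>l<m. u (Js ! l))" for Js
    have "bases \<subseteq> {Js. set Js \<subseteq> E \<and> length Js = m}" unfolding bases_def by auto
    then have "finite bases" using finite_lists_length_eq[OF finite_E] by (rule finite_subset)
    then have "Min (weight ` bases) \<in> weight ` bases" using assms(2) by (intro Min_in) auto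
    then obtain Js where Js: "Js \<in> bases" "weight Js = Min (weight ` bases)" by auto
    then have greedy: "weight Js \<le> weight Ks" if "Ks \<in> bases" for Ks
      using \<open>finite bases\<close> that by simp
    \<comment> \<open>The exchange changes the weight by \<open>u e - u (Js ! l)\<close>, which
      minimality makes nonnegative.\<close>
    have le: "u (Js ! l) \<le> u e" if "e \<in> E" "l < m" "minor (Js[l := e]) \<noteq> 0" for e l
    proof -
      have "weight Ks = u (Ks ! l) + (\<Sum>i\<in>{..<m} - {l}. u (Ks ! i))" for Ks
        unfolding weight_def using that(2) by (intro sum.remove) auto
      moreover have "(\<Sum>i\<in>{..<m} - {l}. u (Js[l := e] ! i)) = (\<Sum>i\<in>{..<m} - {l}. u (Js ! i))"
        by (intro sum.cong) auto
      ultimately have "weight (Js[l := e]) = weight Js - u (Js ! l) + u e"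
        using that(2) bases_length[OF Js(1)] by simp
      then show ?thesis using greedy[OF exchange(1)[OF Js(1) that]] by simp
    qed
    have attained: "\<exists>l<m. minor (Js[l := e]) \<noteq> 0 \<and> u (Js ! l) = u e" if e: "e \<in> E" for e
    proof -
      \<comment> \<open>With this \<open>c\<close> the level set is
        \<open>{x\<in>E. u x < u e}\<close>; the term \<open>u e - 1\<close> serves the case that it
        is empty. Its flatness forces an element of weight at least \<open>u e\<close> into the
        expansion of \<open>e\<close>, and \<open>le\<close> gives equality.\<close>
      define c where "c = Max (insert (u e - 1) (u ` {x\<in>E. u x < u e}))"
      have fin: "finite (u ` {x\<in>E. u x < u e})" using finite_E by simp
      have "c < u e" unfolding c_def using fin by simp
      then obtain l where l: "l < m" "minor (Js[l := e]) \<noteq> 0" "Js ! l \<notin> {x\<in>E. u x \<le> c}"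
        using flat_not_in_span[OF u(2)[of c] _ Js(1), of e] e by auto
      have "Js ! l \<in> E" using bases_subset[OF Js(1)] bases_length[OF Js(1)] l(1) by auto
      have "\<not> u (Js ! l) < u e"
      proof
        assume "u (Js ! l) < u e"
        then have "u (Js ! l) \<le> c" unfolding c_def
          using fin \<open>Js ! l \<in> E\<close> by (intro Max_ge) auto
        then show False using l(3) \<open>Js ! l \<in> E\<close> by simp
      qed
      then show ?thesis using l(1,2) le[OF e l(1,2)] by (intro exI[of _ l]) auto
    qed
    have "\<exists>w\<in>?S. \<forall>e\<in>E. \<bar>w e - u e\<bar> < \<epsilon>" if eps: "\<epsilon> > 0" for \<epsilon>
    proof -
      \<comment> \<open>One choice of distinct values on the basis excludes cancellation in the
        Cramer expansions of all coordinates simultaneously.\<close>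
      obtain p where p: "\<And>b. b \<in> set Js \<Longrightarrow> p b \<noteq> 0 \<and> \<bar>v (p b) - (- u b)\<bar> < \<epsilon>"
        "inj_on (\<lambda>b. v (p b)) (set Js)"
        using perturbed_valuations[OF dense eps, of "set Js" "\<lambda>b. - u b"] by auto
      obtain y where y: "\<And>l. l < m \<Longrightarrow> pairing y (Js ! l) = p (Js ! l)"
        using pairing_prescribed[OF Js(1)] by blast
      have main: "pairing y e \<noteq> 0 \<and> \<bar>- v (pairing y e) - u e\<bar> < \<epsilon>" if e: "e \<in> E" for e
      proof -
        define A where "A = {l. l < m \<and> minor (Js[l := e]) \<noteq> 0}"
        define g where "g l = minor (Js[l := e]) / minor Js * p (Js ! l)" for l
        have mem: "Js ! l \<in> set Js" if "l \<in> A" for l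
          using that bases_length[OF Js(1)] by (auto simp: A_def)
        have g: "g l \<noteq> 0" "v (g l) = v (p (Js ! l))" if "l \<in> A" for l
        proof -
          have nz: "minor (Js[l := e]) \<noteq> 0" "minor Js \<noteq> 0" "p (Js ! l) \<noteq> 0" and "l < m"
            using that Js(1) p(1)[OF mem[OF that]] by (auto simp: A_def bases_def)
          have "v (minor (Js[l := e]) / minor Js) = 0"
            using val_divide[OF nz(1,2)] equal[OF exchange(1)[OF Js(1) e \<open>l < m\<close> nz(1)] Js(1)] by simp
          moreover have "minor (Js[l := e]) / minor Js \<noteq> 0" using nz by simp
          ultimately show "v (g l) = v (p (Js ! l))" unfolding g_def
            using val_mult[of "minor (Js[l := e]) / minor Js" "p (Js ! l)"] nz(3) by linarith
          show "g l \<noteq> 0" using nz by (simp add: g_def)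
        qed
        have "pairing y e = (\<Sum>l<m. g l)"
          unfolding pairing_cramer[OF Js(1), of y e] g_def using y by (intro sum.cong) auto
        also have "\<dots> = sum g A" by (intro sum.mono_neutral_right) (auto simp: A_def g_def)
        finally have pairing: "pairing y e = sum g A" .
        obtain l1 where l1: "l1 \<in> A" "u (Js ! l1) = u e" using attained[OF e] by (auto simp: A_def)
        have "inj_on (\<lambda>l. v (g l)) A"
        proof (rule inj_onI)
          fix l l' assume l: "l \<in> A" "l' \<in> A" "v (g l) = v (g l')"
          then have "Js ! l = Js ! l'" using g(2) inj_onD[OF p(2) _ mem mem, of l l'] by simp
          then show "l = l'" using l(1,2) bases_distinct[OF Js(1)] bases_length[OF Js(1)]
            by (simp add: A_def nth_eq_iff_index_eq)
        qed
        moreover have "finite A" "A \<noteq> {}" using l1 by (auto simp: A_def)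
        ultimately obtain l0 where l0: "sum g A \<noteq> 0" "l0 \<in> A" "v (sum g A) = v (g l0)"
          "\<And>l. l \<in> A \<Longrightarrow> v (g l0) \<le> v (g l)"
          using val_sum_inj[of A g] g(1) by blast
        \<comment> \<open>The least term \<open>l0\<close> decides the value. It is bounded above
          through \<open>l1\<close>, whose prescribed value is close to \<open>- u e\<close>, and
          below because \<open>u (Js ! l0) \<le> u e\<close>.\<close>
        have "v (pairing y e) = v (p (Js ! l0))" using pairing l0 g(2) by simp
        moreover have "v (p (Js ! l0)) \<le> v (p (Js ! l1))" using l0(4)[OF l1(1)] g(2) l0(2) l1(1) by simp
        moreover have "u (Js ! l0) \<le> u e" using l0(2) le[OF e] by (auto simp: A_def)
        ultimately have "\<bar>- v (pairing y e) - u e\<bar> < \<epsilon>"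
          using p(1)[OF mem[OF l0(2)]] p(1)[OF mem[OF l1(1)]] l1(2) by linarith
        then show ?thesis using l0(1) pairing by simp
      qed
      have "(\<lambda>e\<in>E. 0 - v (pairing y e)) \<in> ?S" using main by blast
      moreover have "\<forall>e\<in>E. \<bar>(\<lambda>e\<in>E. 0 - v (pairing y e)) e - u e\<bar> < \<epsilon>" using main by simp
      ultimately show ?thesis by blast
    qed
    then show "u \<in> powertop_real E closure_of ?S" unfolding closure using u(1) by blast
  qed
qed

end

subsection \<open>Matrices with prescribed zeros\<close>

text \<open>Induction on the size of \<open>I\<close>. If every proper nonempty subset has a
  surplus, any choice for one index leaves Hall's condition intact. Otherwise a tight subset
  \<open>S\<close> and its complement are matched separately.\<close>

theorem hall_marriage:
  assumes "finite I" and "\<And>i. i \<in> I \<Longrightarrow> finite (A i)"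
    and "\<And>S. S \<subseteq> I \<Longrightarrow> card S \<le> card (\<Union>i\<in>S. A i)"
  shows "\<exists>g. inj_on g I \<and> (\<forall>i\<in>I. g i \<in> A i)"
  using assms
proof (induction "card I" arbitrary: I A rule: less_induct)
  case less
  note IH = less.hyps and fin = less.prems(1,2) and hall = less.prems(3)
  consider "I = {}" | (loose) "I \<noteq> {}" "\<And>S. S \<subset> I \<Longrightarrow> S \<noteq> {} \<Longrightarrow> card S < card (\<Union>i\<in>S. A i)"
    | (tight) S where "S \<subset> I" "S \<noteq> {}" "card S = card (\<Union>i\<in>S. A i)"
    using hall by (metis le_neq_implies_less psubset_imp_subset)
  then show ?case
  proof cases
    case loose
    then obtain i where i: "i \<in> I" by blast
    have "card {i} \<le> card (A i)" using hall[of "{i}"] i by simp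
    then obtain x where x: "x \<in> A i" using fin(2)[OF i] by fastforce
    have "\<exists>g. inj_on g (I - {i}) \<and> (\<forall>j\<in>I - {i}. g j \<in> A j - {x})"
    proof (rule IH)
      show "card (I - {i}) < card I" using i fin(1) by (rule card_Diff1_less[rotated])
      fix S assume S: "S \<subseteq> I - {i}"
      show "card S \<le> card (\<Union>j\<in>S. A j - {x})"
      proof (cases "S = {}")
        case False
        have "S \<subset> I" using S i by blast
        then have "card S < card (\<Union>j\<in>S. A j)" using loose(2) False by blast
        moreover have "(\<Union>j\<in>S. A j - {x}) = (\<Union>j\<in>S. A j) - {x}" by blast
        ultimately show ?thesis by (auto simp: card_Diff_singleton_if)
      qed simp
    qed (use fin in auto)
    then obtain g where g: "inj_on g (I - {i})" "\<And>j. j \<in> I - {i} \<Longrightarrow> g j \<in> A j - {x}" by blast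
    have "inj_on (g(i := x)) (insert i (I - {i}))"
      using g(2) inj_on_fun_updI[OF g(1), of x i] by (subst inj_on_insert) fastforce
    then show ?thesis using g(2) x i by (intro exI[of _ "g(i := x)"]) (auto simp: insert_absorb)
  next
    case tight
    define B where "B = (\<Union>i\<in>S. A i)"
    have finS: "finite S" and S: "S \<subseteq> I" using tight(1) fin(1) finite_subset by auto
    have "\<exists>g. inj_on g S \<and> (\<forall>i\<in>S. g i \<in> A i)"
      by (rule IH) (use psubset_card_mono[OF fin(1) tight(1)] fin S finS hall in auto)
    then obtain g where g: "inj_on g S" "\<And>i. i \<in> S \<Longrightarrow> g i \<in> A i" by blast
    \<comment> \<open>Hall's condition for \<open>S \<union> T\<close> gives the condition for
      \<open>T\<close> outside \<open>B\<close>, because \<open>B\<close> has exactly as many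
      elements as \<open>S\<close>.\<close>
    have "\<exists>h. inj_on h (I - S) \<and> (\<forall>i\<in>I - S. h i \<in> A i - B)"
    proof (rule IH)
      show "card (I - S) < card I" using tight(2) S fin(1) by (intro psubset_card_mono) auto
      fix T assume T: "T \<subseteq> I - S"
      then have finT: "finite T" using fin(1) finite_subset by blast
      have "card S + card T = card (S \<union> T)" using T finS finT by (subst card_Un_disjoint) auto
      also have "\<dots> \<le> card (\<Union>i\<in>S \<union> T. A i)" using T S by (intro hall) auto
      also have "(\<Union>i\<in>S \<union> T. A i) = B \<union> (\<Union>i\<in>T. A i - B)" unfolding B_def by blast
      also have "card \<dots> \<le> card B + card (\<Union>i\<in>T. A i - B)" by (rule card_Un_le)
      finally show "card T \<le> card (\<Union>i\<in>T. A i - B)" using tight(3) by (simp add: B_def)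
    qed (use fin in auto)
    then obtain h where h: "inj_on h (I - S)" "\<And>i. i \<in> I - S \<Longrightarrow> h i \<in> A i - B" by blast
    define k where "k i = (if i \<in> S then g i else h i)" for i
    have "g i \<in> B" if "i \<in> S" for i using g(2)[OF that] that unfolding B_def by blast
    then have "inj_on k I" using g(1) h unfolding inj_on_def k_def by (metis DiffD2 DiffI)
    moreover have "\<forall>i\<in>I. k i \<in> A i" using g(2) h(2) unfolding k_def by auto
    ultimately show ?thesis by blast
  qed auto
qed

text \<open>Uniqueness of division with remainder: \<open>i * n + j\<close> encodes the matrix
  position \<open>(i, j)\<close>.\<close>

lemma mult_add_eq_cancel:
  fixes i j k l n :: nat
  assumes "j < n" "l < n" "i * n + j = k * n + l"
  shows "i = k \<and> j = l"
proof -
  have "(i * n + j) div n = i" "(k * n + l) div n = k" using assms(1,2) by auto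
  moreover have "(i * n + j) mod n = j" "(k * n + l) mod n = l" using assms(1,2) by auto
  ultimately show ?thesis using assms(3) by auto
qed

text \<open>The zeros are placed by Hall's condition; the other entries are powers of one element of
  nonzero value, with exponents such that no two terms of a Leibniz expansion have the same value.\<close>

lemma zero_pattern_matrix:
  fixes v :: "'a::field \<Rightarrow> real" and Z :: "nat \<Rightarrow> nat set"
  assumes "nonarch_valuation v" "t \<noteq> 0" "v t \<noteq> 0"
    and Z: "\<And>i. i < m \<Longrightarrow> Z i \<subseteq> {..<n}"
    and hall: "\<And>S. S \<subseteq> {..<m} \<Longrightarrow> S \<noteq> {} \<Longrightarrow> card (\<Inter>i\<in>S. Z i) + card S \<le> m"
  shows "\<exists>M :: nat \<Rightarrow> nat \<Rightarrow> 'a. (\<forall>i<m. \<forall>j\<in>Z i. M i j = 0) \<and>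
    (\<forall>cs. length cs = m \<longrightarrow> distinct cs \<longrightarrow> set cs \<subseteq> {..<n} \<longrightarrow>
       det (mat m m (\<lambda>(i, l). M i (cs ! l))) \<noteq> 0)"
proof -
  interpret nonarch_valuation v by fact
  \<comment> \<open>Binary expansions are unique, so the set of positions used by a Leibniz term can
    be recovered from its value.\<close>
  define M where "M i j = (if j \<in> Z i then 0 else t ^ (2 ^ (i * n + j)))" for i j
  have "det (mat m m (\<lambda>(i, l). M i (cs ! l))) \<noteq> 0"
    if cs: "length cs = m" "distinct cs" "set cs \<subseteq> {..<n}" for cs
  proof -
    define A where "A i = {l. l < m \<and> cs ! l \<notin> Z i}" for i
    have "\<exists>g. inj_on g {..<m} \<and> (\<forall>i\<in>{..<m}. g i \<in> A i)"
    proof (rule hall_marriage)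
      fix S assume S: "S \<subseteq> {..<m}"
      show "card S \<le> card (\<Union>i\<in>S. A i)"
      proof (cases "S = {}")
        case False
        \<comment> \<open>\<open>N\<close> holds the chosen columns that are forbidden for every row
          in \<open>S\<close>; all other positions are available to some row of
          \<open>S\<close>.\<close>
        define N where "N = {l. l < m \<and> cs ! l \<in> (\<Inter>i\<in>S. Z i)}"
        obtain k where k: "k \<in> S" "k < m" using False S by blast
        have "finite (\<Inter>i\<in>S. Z i)"
          using k(1) finite_subset[OF Z[OF k(2)]] by (intro finite_INT) auto
        moreover have "(!) cs ` N \<subseteq> (\<Inter>i\<in>S. Z i)" unfolding N_def by blast
        moreover have "inj_on ((!) cs) N" using cs by (auto simp: inj_on_def N_def nth_eq_iff_index_eq)
        ultimately have "card N \<le> card (\<Inter>i\<in>S. Z i)" using card_inj_on_le by blast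
        moreover have "(\<Union>i\<in>S. A i) = {..<m} - N" unfolding A_def N_def by blast
        moreover have "card ({..<m} - N) = m - card N"
          by (subst card_Diff_subset) (auto simp: N_def)
        ultimately show ?thesis using hall[OF S False] by simp
      qed simp
    qed (auto simp: A_def)
    then obtain g where g: "inj_on g {..<m}" "\<And>i. i < m \<Longrightarrow> g i \<in> A i" by blast
    \<comment> \<open>The matching is extended by the identity, as \<open>permutes\<close>
      demands.\<close>
    define q where "q i = (if i < m then g i else i)" for i
    have "q permutes {0..<m}"
    proof (rule bij_imp_permutes)
      have "inj_on q {0..<m}" using g(1) by (auto simp: inj_on_def q_def)
      moreover have "q ` {0..<m} \<subseteq> {0..<m}" using g(2) by (auto simp: q_def A_def)
      ultimately show "bij_betw q {0..<m} {0..<m}"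
        by (simp add: bij_betw_def endo_inj_surj)
    qed (auto simp: q_def)
    define summand where "summand p = signof p * (\<Prod>i = 0..<m. M i (cs ! p i))" for p
    \<comment> \<open>\<open>P\<close> indexes the Leibniz terms that avoid all zeros. It contains
      \<open>q\<close>, and distinct members have terms of distinct values.\<close>
    define P where "P = {p. p permutes {0..<m} \<and> (\<forall>i<m. p i \<in> A i)}"
    have P: "p i < m" "cs ! p i \<notin> Z i" "cs ! p i < n" if "p \<in> P" "i < m" for p i
    proof -
      show "p i < m" "cs ! p i \<notin> Z i" using that by (auto simp: P_def A_def)
      then show "cs ! p i < n" using cs(1,3) by (metis lessThan_iff nth_mem subsetD)
    qed
    have finP: "finite P"
      using finite_permutations[of "{0..<m}"] by (rule rev_finite_subset) (auto simp: P_def)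
    define expo :: "(nat \<Rightarrow> nat) \<Rightarrow> nat" where "expo p = (\<Sum>i<m. 2 ^ (i * n + cs ! p i))" for p
    have val: "summand p \<noteq> 0 \<and> v (summand p) = real (expo p) * v t" if "p \<in> P" for p
    proof -
      have sign: "signof p \<noteq> (0::'a)" "v (signof p) = 0"
        by (auto simp: sign_def val_minus val_one)
      have "(\<Prod>i = 0..<m. M i (cs ! p i)) = (\<Prod>i = 0..<m. t ^ (2 ^ (i * n + cs ! p i)))"
        using P(2)[OF that] by (intro prod.cong) (auto simp: M_def)
      also have "\<dots> = t ^ expo p"
        by (simp add: power_sum lessThan_atLeast0 expo_def)
      finally have "summand p = signof p * t ^ expo p"
        unfolding summand_def by simp
      then show ?thesis using sign assms(2) val_power val_mult by simp
    qed
    have "inj_on (\<lambda>p. v (summand p)) P"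
    proof (rule inj_onI)
      fix p p' assume p: "p \<in> P" "p' \<in> P" and "v (summand p) = v (summand p')"
      then have "real (expo p) * v t = real (expo p') * v t" using val p by simp
      then have sums: "expo p = expo p'" using assms(3) by simp
      have enc: "expo r = set_encode ((\<lambda>i. i * n + cs ! r i) ` {..<m})"
        if "r \<in> P" for r
      proof -
        have "inj_on (\<lambda>i. i * n + cs ! r i) {..<m}"
        proof (rule inj_onI)
          fix i k assume "i \<in> {..<m}" "k \<in> {..<m}" "i * n + cs ! r i = k * n + cs ! r k"
          then show "i = k" using mult_add_eq_cancel[OF P(3)[OF that, of i] P(3)[OF that, of k]] by simp
        qed
        then show ?thesis unfolding set_encode_def expo_def by (simp add: sum.reindex)
      qed
      have sets: "(\<lambda>i. i * n + cs ! p i) ` {..<m} = (\<lambda>i. i * n + cs ! p' i) ` {..<m}"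
        using sums enc p by (simp add: set_encode_eq)
      have "p i = p' i" if "i < m" for i
      proof -
        have "i * n + cs ! p i \<in> (\<lambda>i. i * n + cs ! p' i) ` {..<m}"
          unfolding sets[symmetric] using that by blast
        then obtain k where "k < m" "i * n + cs ! p i = k * n + cs ! p' k" by blast
        then have "cs ! p i = cs ! p' i"
          using mult_add_eq_cancel[OF P(3)[OF p(1) that] P(3)[OF p(2) \<open>k < m\<close>]] by blast
        then show ?thesis using P(1)[OF p(1) that] P(1)[OF p(2) that] cs
          by (simp add: nth_eq_iff_index_eq)
      qed
      moreover have "p i = p' i" if "\<not> i < m" for i
        using p that permutes_not_in[of p "{0..<m}" i] permutes_not_in[of p' "{0..<m}" i]
        by (simp add: P_def)
      ultimately show "p = p'" by blast
    qed
    moreover have "q \<in> P" using \<open>q permutes {0..<m}\<close> g(2) by (auto simp: P_def q_def)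
    ultimately have "sum summand P \<noteq> 0" using val_sum_inj(1)[of P summand] finP val by blast
    moreover have "det (mat m m (\<lambda>(i, l). M i (cs ! l))) = sum summand {p. p permutes {0..<m}}"
      unfolding det_def summand_def by (auto intro!: sum.cong prod.cong simp: permutes_in_image)
    moreover have "sum summand {p. p permutes {0..<m}} = sum summand P"
    proof (intro sum.mono_neutral_right ballI)
      fix p assume p: "p \<in> {p. p permutes {0..<m}} - P"
      then obtain i where "i < m" "p i \<notin> A i" by (auto simp: P_def)
      moreover have "p i < m" using p \<open>i < m\<close> permutes_in_image[of p "{0..<m}" i] by simp
      ultimately have "M i (cs ! p i) = 0" by (simp add: A_def M_def)
      then show "summand p = 0" unfolding summand_def using \<open>i < m\<close> by (auto intro!: bexI[of _ i])
    qed (auto simp: P_def finite_permutations)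
    ultimately show ?thesis by simp
  qed
  then show ?thesis by (intro exI[of _ M]) (auto simp: M_def)
qed

subsection \<open>The matrix \<open>V\<close>\<close>

text \<open>The increasing order given by \<open>pick\<close> is the column order of
  \<open>submatrix\<close>.\<close>

definition col_list :: "nat set \<Rightarrow> nat list" where
  "col_list J = map (pick J) [0..<card J]"

lemma col_list:
  assumes "finite J"
  shows "length (col_list J) = card J" "distinct (col_list J)" "set (col_list J) = J"
proof -
  have "inj_on (pick J) {..<card J}"
  proof (rule inj_onI)
    fix a b assume ab: "a \<in> {..<card J}" "b \<in> {..<card J}" and eq: "pick J a = pick J b"
    have "card {x\<in>J. x < pick J a} = a" "card {x\<in>J. x < pick J b} = b"
      using ab by (auto intro: card_pick_le)
    then show "a = b" unfolding eq by (rule trans[OF sym])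
  qed
  then show "distinct (col_list J)"
    by (simp add: col_list_def distinct_map lessThan_atLeast0)
  then have "card (set (col_list J)) = card J"
    by (simp add: distinct_card) (simp add: col_list_def)
  moreover have "set (col_list J) \<subseteq> J" using pick_in_set_le by (auto simp: col_list_def)
  ultimately show "set (col_list J) = J" using assms by (metis card_subset_eq)
qed (simp add: col_list_def)

text \<open>The matrix \<open>[y | W^J]\<close>. Column \<open>0\<close> is taken by
  \<open>y\<close>, which shifts the columns picked from \<open>W\<close> by one.\<close>

definition augmented :: "nat \<Rightarrow> 'a mat \<Rightarrow> (nat \<Rightarrow> 'a) \<Rightarrow> nat set \<Rightarrow> 'a mat" where
  "augmented d W y J = mat (d + 1) (d + 1) (\<lambda>(i, l). if l = 0 then y i else W $$ (i, pick J (l - 1)))"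

lemma augmented_carrier [simp]: "augmented d W y J \<in> carrier_mat (d + 1) (d + 1)"
  by (simp add: augmented_def)

text \<open>This is also how \<open>mat_delete\<close> renumbers rows; it identifies the row
  selection in \<open>V_entry\<close> with a Laplace minor.\<close>

lemma pick_delete:
  assumes "i < Suc d" "a < d"
  shows "pick ({..<Suc d} - {i}) a = (if a < i then a else Suc a)"
proof -
  define b where "b = (if a < i then a else Suc a)"
  define S where "S = {..<Suc d} - {i}"
  have "b \<in> S" using assms by (auto simp: b_def S_def)
  moreover have "card {x\<in>S. x < b} = a"
  proof (cases "a < i")
    case True
    then have "{x\<in>S. x < b} = {..<a}" using assms by (auto simp: b_def S_def)
    then show ?thesis by simp
  next
    case False
    then have "{x\<in>S. x < b} = {..<Suc a} - {i}" using assms by (auto simp: b_def S_def)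
    then show ?thesis using False by simp
  qed
  ultimately show ?thesis using pick_card_in_set[of b S] unfolding b_def S_def by simp
qed

text \<open>Laplace expansion along column \<open>0\<close>: the sign in \<open>V_entry\<close> is
  the cofactor sign at position \<open>(i, 0)\<close>.\<close>

lemma sum_V_entry:
  assumes W: "W \<in> carrier_mat (d + 1) n" and J: "J \<in> [{..<n}]\<^bsup>d\<^esup>"
  shows "(\<Sum>i<d + 1. y i * V_entry d W i J) = det (augmented d W y J)"
proof -
  define A where "A = augmented d W y J"
  have A: "A \<in> carrier_mat (d + 1) (d + 1)" by (simp only: A_def augmented_carrier)
  have "det A = (\<Sum>i<d + 1. A $$ (i, 0) * cofactor A i 0)"
    by (rule laplace_expansion_column[OF A]) simp
  also have "\<dots> = (\<Sum>i<d + 1. y i * V_entry d W i J)"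
  proof (intro sum.cong refl)
    fix i assume i: "i \<in> {..<d + 1}"
    have "{j. j < n \<and> j \<in> J} = J" "card J = d" using J by (auto simp: nsets_def)
    moreover have "{i'. i' < d + 1 \<and> i' \<in> {..<d + 1} - {i}} = {..<d + 1} - {i}" by auto
    moreover have "card ({..<d + 1} - {i}) = d" using i by simp
    ultimately have "submatrix W ({..<d + 1} - {i}) J = mat_delete A i 0"
      using W A i pick_delete[of i d]
      by (intro eq_matI) (auto simp: submatrix_def mat_delete_def A_def augmented_def)
    then show "A $$ (i, 0) * cofactor A i 0 = y i * V_entry d W i J"
      using i by (simp add: V_entry_def cofactor_def A_def augmented_def)
  qed
  finally show ?thesis by (simp add: A_def)
qed

lemma augmented_eq_col_list:
  assumes J: "J \<in> [{..<n}]\<^bsup>d\<^esup>"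
  shows "augmented d W (\<lambda>i. W $$ (i, j)) J = mat (d + 1) (d + 1) (\<lambda>(i, l). W $$ (i, (j # col_list J) ! l))"
proof -
  have "card J = d" using J by (auto simp: nsets_def)
  then show ?thesis unfolding augmented_def col_list_def
    by (intro eq_matI) (auto simp: nth_Cons split: nat.split)
qed

lemma det_augmented_column:
  fixes W :: "'a::field mat"
  assumes J: "J \<in> [{..<n}]\<^bsup>d\<^esup>" and "j \<in> J"
  shows "det (augmented d W (\<lambda>i. W $$ (i, j)) J) = 0"
proof -
  have J': "finite J" "card J = d" using J by (auto simp: nsets_def)
  then obtain l where l: "l < d" "col_list J ! l = j"
    using col_list[OF J'(1)] \<open>j \<in> J\<close> by (metis in_set_conv_nth)
  show ?thesis unfolding augmented_eq_col_list[OF J]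
    by (rule det_identical_columns[of _ "d + 1" 0 "Suc l"]) (use l in auto)
qed

text \<open>For \<open>m \<le> n\<close> this says that the columns of \<open>W\<close> represent
  the uniform matroid of rank \<open>m\<close> on \<open>n\<close> elements.\<close>

definition maximal_minors_nonzero :: "nat \<Rightarrow> nat \<Rightarrow> 'a::field mat \<Rightarrow> bool" where
  "maximal_minors_nonzero m n W \<longleftrightarrow> (\<forall>cs. length cs = m \<longrightarrow> distinct cs \<longrightarrow> set cs \<subseteq> {..<n} \<longrightarrow>
     det (mat m m (\<lambda>(i, l). W $$ (i, cs ! l))) \<noteq> 0)"

lemma det_augmented_new_column:
  assumes "maximal_minors_nonzero (d + 1) n W" and J: "J \<in> [{..<n}]\<^bsup>d\<^esup>" and "j < n" "j \<notin> J"
  shows "det (augmented d W (\<lambda>i. W $$ (i, j)) J) \<noteq> 0"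
proof -
  have J': "finite J" "card J = d" "J \<subseteq> {..<n}" using J by (auto simp: nsets_def)
  show ?thesis unfolding augmented_eq_col_list[OF J]
    using assms(1)[unfolded maximal_minors_nonzero_def, rule_format, of "j # col_list J"]
      col_list[OF J'(1)] J' assms(3,4) by simp
qed

text \<open>Deleting a row other than \<open>k\<close> leaves the zero row \<open>k\<close> in the
  minor. Entry \<open>k\<close> itself survives because pairing the column \<open>J\<close> of
  \<open>V\<close> with a column of \<open>W\<close> outside \<open>J\<close> gives a maximal minor
  of \<open>W\<close>.\<close>

lemma V_entry_vanishing_row:
  assumes W: "W \<in> carrier_mat (d + 1) n" and "maximal_minors_nonzero (d + 1) n W" and "n \<ge> d + 1"
    and J: "J \<in> [{..<n}]\<^bsup>d\<^esup>" and k: "k < d + 1" "\<And>j. j \<in> J \<Longrightarrow> W $$ (k, j) = 0"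
  shows "V_entry d W k J \<noteq> 0" and "\<And>i. i < d + 1 \<Longrightarrow> i \<noteq> k \<Longrightarrow> V_entry d W i J = 0"
proof -
  have J': "finite J" "card J = d" "J \<subseteq> {..<n}" using J by (auto simp: nsets_def)
  show zero: "V_entry d W i J = 0" if i: "i < d + 1" "i \<noteq> k" for i
  proof -
    define y where "y i' = (if i' = i then 1 else 0 :: 'a)" for i'
    have "augmented d W y J $$ (k, l) = 0" if "l < d + 1" for l
      using that k i(2) pick_in_set_le[of "l - 1" J] J' by (auto simp: augmented_def y_def)
    then have "det (augmented d W y J) = 0"
      using k(1) by (subst laplace_expansion_row[OF augmented_carrier k(1)]) auto
    moreover have "(\<Sum>i'<d + 1. y i' * V_entry d W i' J) = V_entry d W i J"
      using i by (subst sum.remove[of _ i]) (auto simp: y_def intro!: sum.neutral)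
    ultimately show ?thesis using sum_V_entry[OF W J, of y] by simp
  qed
  have "card J < card {..<n}" using J' assms(3) by simp
  then obtain j where j: "j < n" "j \<notin> J"
    by (metis card_mono finite_lessThan J'(1) lessThan_iff not_less subsetI)
  have "(\<Sum>i<d + 1. W $$ (i, j) * V_entry d W i J) \<noteq> 0"
    unfolding sum_V_entry[OF W J] by (rule det_augmented_new_column[OF assms(2) J j])
  moreover have "(\<Sum>i<d + 1. W $$ (i, j) * V_entry d W i J) = W $$ (k, j) * V_entry d W k J"
    using k(1) zero by (subst sum.remove[of _ k]) (auto intro!: sum.neutral)
  ultimately show "V_entry d W k J \<noteq> 0" by auto
qed

text \<open>Take for \<open>J l\<close> the first \<open>d + 1\<close> columns without
  \<open>l\<close>. Multiplying the minor of \<open>V\<close> by the transpose of these columns of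
  \<open>W\<close> gives entries \<open>det [w_k | W^(J l)]\<close>: a column is repeated off the
  diagonal, and the diagonal consists of maximal minors up to sign.\<close>

lemma exists_V_minor_nonzero:
  fixes W :: "'a::field mat"
  assumes W: "W \<in> carrier_mat (d + 1) n" and "maximal_minors_nonzero (d + 1) n W" and "n \<ge> d + 1"
  shows "\<exists>Js. length Js = d + 1 \<and> set Js \<subseteq> [{..<n}]\<^bsup>d\<^esup> \<and> V_minor d W Js \<noteq> 0"
proof -
  define J where "J l = {..<d + 1} - {l}" for l
  define Js where "Js = map J [0..<d + 1]"
  have J: "J l \<in> [{..<n}]\<^bsup>d\<^esup>" if "l < d + 1" for l
    using that assms(3) by (auto simp: J_def nsets_def)
  define U where "U = mat (d + 1) (d + 1) (\<lambda>(k, i). W $$ (i, k))"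
  define V where "V = mat (d + 1) (d + 1) (\<lambda>(i, l). V_entry d W i (J l))"
  have UV: "U \<in> carrier_mat (d + 1) (d + 1)" "V \<in> carrier_mat (d + 1) (d + 1)"
    by (auto simp: U_def V_def)
  have dims: "dim_row U = d + 1" "dim_col V = d + 1" by (simp_all add: U_def V_def)
  have entry: "(U * V) $$ (k, l) = det (augmented d W (\<lambda>i. W $$ (i, k)) (J l))" if "k < d + 1" "l < d + 1" for k l
  proof -
    have "(U * V) $$ (k, l) = (\<Sum>i<d + 1. W $$ (i, k) * V_entry d W i (J l))"
      using that dims index_mult_mat(1)[of k U l V] unfolding scalar_prod_def
      by (auto simp: U_def V_def lessThan_atLeast0 intro!: sum.cong)
    then show ?thesis unfolding sum_V_entry[OF W J[OF that(2)]] .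
  qed
  have "det (U * V) = prod_list (diag_mat (U * V))"
  proof (rule det_lower_triangular)
    fix k l assume "k < l" "l < d + 1"
    moreover from this have "k \<in> J l" by (auto simp: J_def)
    ultimately show "(U * V) $$ (k, l) = 0"
      using entry[of k l] det_augmented_column[OF J, of l k W] by simp
  qed (use UV in auto)
  moreover have "0 \<notin> set (diag_mat (U * V))"
  proof
    assume "0 \<in> set (diag_mat (U * V))"
    then obtain l where l: "l < d + 1" "(U * V) $$ (l, l) = 0" using UV by (auto simp: diag_mat_def simp del: upt_Suc)
    then show False
      using entry[OF l(1) l(1)] det_augmented_new_column[OF assms(2) J[OF l(1)], of l] assms(3) by (auto simp: J_def)
  qed
  ultimately have "det (U * V) \<noteq> 0" by (simp add: prod_list_zero_iff)
  then have "det V \<noteq> 0" using det_mult[OF UV] by auto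
  moreover have "V_minor d W Js = det V"
    unfolding V_minor_def V_def Js_def by (intro arg_cong[of _ _ det] eq_matI) (auto simp del: upt_Suc)
  ultimately show ?thesis using J by (intro exI[of _ Js]) (auto simp: Js_def)
qed

text \<open>Some Leibniz term is nonzero, and its permutation maps \<open>R\<close> injectively into
  the complement of \<open>C\<close>.\<close>

lemma zero_block_bound:
  fixes N :: "'a::field mat"
  assumes N: "N \<in> carrier_mat m m" "det N \<noteq> 0" and "R \<subseteq> {..<m}" "C \<subseteq> {..<m}"
    and zero: "\<And>r c. r \<in> R \<Longrightarrow> c \<in> C \<Longrightarrow> N $$ (r, c) = 0"
  shows "card R + card C \<le> m"
proof -
  have "(\<Sum>p | p permutes {0..<m}. signof p * (\<Prod>i = 0..<m. N $$ (i, p i))) \<noteq> 0"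
    using N(2) det_def'[OF N(1)] by simp
  then obtain p where "p permutes {0..<m}" "signof p * (\<Prod>i = 0..<m. N $$ (i, p i)) \<noteq> 0"
    by (rule sum.not_neutral_contains_not_neutral) blast
  then have p: "p permutes {0..<m}" "\<And>i. i < m \<Longrightarrow> N $$ (i, p i) \<noteq> 0" by auto
  have "p i < m" if "i < m" for i using permutes_in_image[OF p(1), of i] that by simp
  then have "p ` R \<subseteq> {..<m} - C" using p(2) zero assms(3) by blast
  then have "card (p ` R) \<le> card ({..<m} - C)" by (intro card_mono) auto
  moreover have "card (p ` R) = card R" using permutes_inj_on[OF p(1)] by (rule card_image)
  moreover have "card ({..<m} - C) = m - card C"
    using assms(4) by (subst card_Diff_subset) (auto intro: finite_subset)
  moreover have "card C \<le> m" using card_mono[OF _ assms(4)] by simp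
  ultimately show ?thesis by simp
qed

subsection \<open>The matroid of \<open>L(X)\<close>\<close>

text \<open>The zero block of \<open>V\<^sup>T * B\<close> has its rows at the sets in the subfamily
  and its columns at their common elements: the entry for a set and a column \<open>j\<close> in it
  is a determinant with a repeated column.\<close>

lemma dilworth_indep_if_V_minor_nonzero:
  fixes W :: "'a::field mat"
  assumes W: "W \<in> carrier_mat (d + 1) n" and "n \<ge> d + 1"
    and Js: "length Js = d + 1" "distinct Js" "set Js \<subseteq> [{..<n}]\<^bsup>d\<^esup>" "V_minor d W Js \<noteq> 0"
    and I: "I \<subseteq> set Js"
  shows "dilworth_indep n (n - d) I"
  unfolding dilworth_indep_def
proof (intro conjI allI impI)
  have [simp]: "n - (n - d) = d" using assms(2) by simp
  show "I \<subseteq> nsets {..<n} (n - (n - d))" using I Js(3) by simp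
  fix \<S> assume \<S>: "\<S> \<subseteq> I" "\<S> \<noteq> {}"
  define V where "V = mat (d + 1) (d + 1) (\<lambda>(i, l). V_entry d W i (Js ! l))"
  have V: "V \<in> carrier_mat (d + 1) (d + 1)" "det V \<noteq> 0"
    using Js(4) unfolding V_def V_minor_def by (simp_all only: mat_carrier not_False_eq_True)
  have VT: "V\<^sup>T \<in> carrier_mat (d + 1) (d + 1)" "det (V\<^sup>T) \<noteq> 0"
    using V det_transpose[OF V(1)] by (simp_all only: transpose_carrier_mat not_False_eq_True)
  have nth: "Js ! l \<in> [{..<n}]\<^bsup>d\<^esup>" if "l < d + 1" for l using Js(1,3) that by (metis nth_mem subsetD)
  obtain J where "J \<in> \<S>" using \<S>(2) by blast
  then obtain l0 where l0: "l0 < d + 1" "Js ! l0 = J" using \<S>(1) I Js(1) by (metis in_set_conv_nth subsetD)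
  have J: "J \<in> [{..<n}]\<^bsup>d\<^esup>" using nth[OF l0(1)] l0(2) by simp
  then have J': "finite J" "card J = d" by (auto simp: nsets_def)
  \<comment> \<open>A nonzero entry in the column of \<open>J\<close> supplies a unit vector
    \<open>y\<close> for which \<open>[y | W^J]\<close> is invertible.\<close>
  have "\<exists>i<d + 1. V_entry d W i J \<noteq> 0"
  proof (rule ccontr)
    assume none: "\<not> ?thesis"
    have "det V = (\<Sum>i<d + 1. V $$ (i, l0) * cofactor V i l0)"
      by (rule laplace_expansion_column[OF V(1) l0(1)])
    also have "\<dots> = 0" using none l0 by (intro sum.neutral) (auto simp: V_def)
    finally show False using V(2) by simp
  qed
  then obtain i where i: "i < d + 1" "V_entry d W i J \<noteq> 0" by blast
  define B where "B = augmented d W (\<lambda>i'. if i' = i then 1 else 0) J"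
  have B: "B \<in> carrier_mat (d + 1) (d + 1)" by (simp only: B_def augmented_carrier)
  have "det B = V_entry d W i J"
    unfolding B_def sum_V_entry[OF W J, symmetric]
    using i(1) by (subst sum.remove[of _ i]) (auto intro!: sum.neutral)
  then have detN: "det (V\<^sup>T * B) \<noteq> 0" using det_mult[OF VT(1) B] VT(2) i(2) by simp
  define R where "R = {l. l < d + 1 \<and> Js ! l \<in> \<S>}"
  \<comment> \<open>Column \<open>0\<close> of \<open>B\<close> is the auxiliary vector, so the
    common elements sit in columns shifted by one.\<close>
  define C where "C = {c. c < d + 1 \<and> c \<noteq> 0 \<and> pick J (c - 1) \<in> \<Inter>\<S>}"
  have "card R + card C \<le> d + 1"
  proof (rule zero_block_bound)
    show "V\<^sup>T * B \<in> carrier_mat (d + 1) (d + 1)" using VT(1) B by (rule mult_carrier_mat)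
    fix r c assume rc: "r \<in> R" "c \<in> C"
    define j where "j = pick J (c - 1)"
    have r: "r < d + 1" "Js ! r \<in> \<S>" and c: "c < d + 1" "c \<noteq> 0" using rc by (auto simp: R_def C_def)
    have "(V\<^sup>T * B) $$ (r, c) = (\<Sum>i<d + 1. W $$ (i, j) * V_entry d W i (Js ! r))"
      using r c V(1) B index_mult_mat(1)[of r "V\<^sup>T" c B] unfolding scalar_prod_def
      by (auto simp: B_def V_def augmented_def lessThan_atLeast0 j_def mult.commute intro!: sum.cong)
    also have "\<dots> = 0"
      unfolding sum_V_entry[OF W nth[OF r(1)]]
      by (rule det_augmented_column[OF nth[OF r(1)]]) (use rc r in \<open>auto simp: C_def j_def\<close>)
    finally show "(V\<^sup>T * B) $$ (r, c) = 0" .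
  qed (use detN in \<open>auto simp: R_def C_def\<close>)
  moreover have "card R = card \<S>"
  proof -
    have "(!) Js ` R = \<S>"
    proof
      show "\<S> \<subseteq> (!) Js ` R"
      proof
        fix x assume "x \<in> \<S>"
        then obtain l where "l < d + 1" "Js ! l = x" using \<S>(1) I Js(1) by (metis in_set_conv_nth subsetD)
        then show "x \<in> (!) Js ` R" using \<open>x \<in> \<S>\<close> by (auto simp: R_def)
      qed
    qed (auto simp: R_def)
    moreover have "inj_on ((!) Js) R" using Js(1,2) by (auto simp: inj_on_def R_def nth_eq_iff_index_eq)
    ultimately show ?thesis using card_image by fastforce
  qed
  moreover have "card (\<Inter>\<S>) \<le> card C"
  proof -
    have "\<Inter>\<S> \<subseteq> (\<lambda>c. pick J (c - 1)) ` C"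
    proof
      fix x assume "x \<in> \<Inter>\<S>"
      then have "x \<in> J" using \<open>J \<in> \<S>\<close> by blast
      then have "x \<in> set (col_list J)" by (simp only: col_list(3)[OF J'(1)])
      then obtain l where "l < d" "pick J l = x" using J'(2) by (auto simp: col_list_def)
      then show "x \<in> (\<lambda>c. pick J (c - 1)) ` C"
        using \<open>x \<in> \<Inter>\<S>\<close> by (intro image_eqI[of _ _ "Suc l"]) (auto simp: C_def)
    qed
    then show ?thesis by (rule surj_card_le[rotated]) (simp add: C_def)
  qed
  ultimately show "card (\<Inter>\<S>) + card \<S> \<le> n - (n - d) + 1" by simp
qed

text \<open>Let row \<open>i\<close> of \<open>W\<close> vanish on the \<open>i\<close>-th set of
  \<open>I\<close>. The corresponding columns of \<open>V\<close> are nonzero multiples of distinct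
  unit vectors, so they extend to a basis; the extension is found as a basis sharing as many
  elements as possible with \<open>I\<close>.\<close>

lemma exists_V_minor_if_dilworth_indep:
  fixes v :: "'a::field \<Rightarrow> real"
  assumes "nonarch_valuation v" "t \<noteq> 0" "v t \<noteq> 0" and "n \<ge> d + 1"
    and I: "dilworth_indep n (n - d) I"
  shows "\<exists>W :: 'a mat. W \<in> carrier_mat (d + 1) n \<and> maximal_minors_nonzero (d + 1) n W \<and>
    (\<exists>Js\<in>V_columns d n. V_minor d W Js \<noteq> 0 \<and> I \<subseteq> set Js)"
proof -
  have nd: "n - (n - d) = d" using assms(4) by simp
  have IE: "I \<subseteq> [{..<n}]\<^bsup>d\<^esup>"
    and bound: "\<And>\<S>. \<S> \<subseteq> I \<Longrightarrow> \<S> \<noteq> {} \<Longrightarrow> card (\<Inter>\<S>) + card \<S> \<le> d + 1"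
    using I unfolding dilworth_indep_def nd by auto
  have finE: "finite ([{..<n}]\<^bsup>d\<^esup>)" by (simp add: finite_imp_finite_nsets)
  then have finI: "finite I" using IE finite_subset by blast
  then obtain Is where Is: "set Is = I" "distinct Is" using finite_distinct_list by blast
  \<comment> \<open>Rows beyond the members of \<open>I\<close> get no prescribed zeros, and a
    family involving such a row has empty intersection.\<close>
  define Z where "Z i = (if i < length Is then Is ! i else {})" for i
  have Z: "Z i \<subseteq> {..<n}" for i
    using nth_mem[of i Is] Is(1) IE by (auto simp: Z_def nsets_def)
  have hall: "card (\<Inter>i\<in>S. Z i) + card S \<le> d + 1" if S: "S \<subseteq> {..<d + 1}" "S \<noteq> {}" for S
  proof (cases "S \<subseteq> {..<length Is}")
    case True
    have "inj_on Z S" using True Is(2) by (auto simp: inj_on_def Z_def nth_eq_iff_index_eq subset_iff)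
    moreover have "Z ` S \<subseteq> I" using True Is(1) by (auto simp: Z_def subset_iff)
    ultimately show ?thesis using bound[of "Z ` S"] S(2) card_image[of Z S] by simp
  next
    case False
    then obtain i where "i \<in> S" "\<not> i < length Is" by blast
    then have "i \<in> S" "Z i = {}" by (auto simp: Z_def)
    then have "(\<Inter>i\<in>S. Z i) = {}" by blast
    moreover have "card S \<le> d + 1" using card_mono[OF _ S(1)] by simp
    ultimately show ?thesis by simp
  qed
  obtain M :: "nat \<Rightarrow> nat \<Rightarrow> 'a" where M: "\<And>i j. i < d + 1 \<Longrightarrow> j \<in> Z i \<Longrightarrow> M i j = 0"
    "\<And>cs. length cs = d + 1 \<Longrightarrow> distinct cs \<Longrightarrow> set cs \<subseteq> {..<n} \<Longrightarrow>
       det (mat (d + 1) (d + 1) (\<lambda>(i, l). M i (cs ! l))) \<noteq> 0"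
    using zero_pattern_matrix[OF assms(1-3) Z hall] by blast
  define W where "W = mat (d + 1) n (\<lambda>(i, j). M i j)"
  have W: "W \<in> carrier_mat (d + 1) n" by (simp only: W_def mat_carrier)
  have minors: "maximal_minors_nonzero (d + 1) n W"
    unfolding maximal_minors_nonzero_def
  proof (intro allI impI)
    fix cs assume cs: "length cs = d + 1" "distinct cs" "set cs \<subseteq> {..<n}"
    have "mat (d + 1) (d + 1) (\<lambda>(i, l). W $$ (i, cs ! l)) = mat (d + 1) (d + 1) (\<lambda>(i, l). M i (cs ! l))"
      using cs nth_mem[of _ cs] by (intro eq_matI) (auto simp: W_def subset_iff)
    then show "det (mat (d + 1) (d + 1) (\<lambda>(i, l). W $$ (i, cs ! l))) \<noteq> 0" using M(2)[OF cs] by simp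
  qed
  have card_le: "length Is \<le> d + 1"
    using bound[of I] Is distinct_card[OF Is(2)] by (cases "I = {}") auto
  interpret vector_configuration "d + 1" "[{..<n}]\<^bsup>d\<^esup>" "\<lambda>J i. V_entry d W i J"
    by unfold_locales (rule finE)
  have minor: "minor Js = V_minor d W Js" for Js unfolding minor_def V_minor_def ..
  have "bases \<noteq> {}"
  proof -
    obtain Js where "length Js = d + 1" "set Js \<subseteq> [{..<n}]\<^bsup>d\<^esup>" "V_minor d W Js \<noteq> 0"
      using exists_V_minor_nonzero[OF W minors assms(4)] by blast
    then have "Js \<in> bases" unfolding bases_def minor by blast
    then show ?thesis by blast
  qed
  define common where "common Js = card (set Js \<inter> I)" for Js
  have "\<forall>Js. Js \<in> bases \<longrightarrow> common Js < Suc (card I)"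
    unfolding common_def by (simp add: less_Suc_eq_le card_mono finI)
  moreover obtain Ks where "Ks \<in> bases" using \<open>bases \<noteq> {}\<close> by blast
  ultimately have "\<exists>Js. Js \<in> bases \<and> (\<forall>Ks. Ks \<in> bases \<longrightarrow> common Ks \<le> common Js)"
    by (intro ex_has_greatest_nat)
  then obtain Js where Js: "Js \<in> bases" "\<And>Ks. Ks \<in> bases \<Longrightarrow> common Ks \<le> common Js" by blast
  have "I \<subseteq> set Js"
  proof (rule ccontr)
    assume "\<not> I \<subseteq> set Js"
    then obtain J where J: "J \<in> I" "J \<notin> set Js" by blast
    then obtain k where k: "k < length Is" "Is ! k = J" using Is(1) by (metis in_set_conv_nth)
    have kd: "k < d + 1" using k card_le by simp
    \<comment> \<open>Pairing with this unit vector reads off row \<open>k\<close> of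
      \<open>V\<close>, the only row in which column \<open>J\<close> is nonzero.\<close>
    define y where "y i = (if i = k then 1 else 0 :: 'a)" for i
    have pairing_y: "pairing y K = V_entry d W k K" for K
      unfolding pairing_def y_def using kd by (subst sum.remove[of _ k]) (auto intro!: sum.neutral)
    have row: "V_entry d W i (Is ! i) \<noteq> 0"
      "\<And>i'. i' < d + 1 \<Longrightarrow> i' \<noteq> i \<Longrightarrow> V_entry d W i' (Is ! i) = 0" if i: "i < length Is" for i
    proof -
      have mem: "Is ! i \<in> [{..<n}]\<^bsup>d\<^esup>" using Is(1) IE i by auto
      have "W $$ (i, j) = 0" if "j \<in> Is ! i" for j
        using M(1)[of i j] i that card_le mem by (auto simp: W_def Z_def nsets_def)
      then show "V_entry d W i (Is ! i) \<noteq> 0"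
        "\<And>i'. i' < d + 1 \<Longrightarrow> i' \<noteq> i \<Longrightarrow> V_entry d W i' (Is ! i) = 0"
        using V_entry_vanishing_row[OF W minors assms(4) mem, of i] i card_le by auto
    qed
    \<comment> \<open>By maximality of the overlap, \<open>J\<close> can only replace members of
      \<open>I\<close>. These are multiples of unit vectors other than the \<open>k\<close>-th, so
      the expansion of row \<open>k\<close> at \<open>J\<close> vanishes.\<close>
    have "minor (Js[l := J]) / minor Js * pairing y (Js ! l) = 0" if l: "l < d + 1" for l
    proof (cases "minor (Js[l := J]) = 0")
      case False
      note ex = exchange[OF Js(1) subsetD[OF IE J(1)] l False]
      have "Js ! l \<in> I"
      proof (rule ccontr)
        assume "Js ! l \<notin> I"
        then have "set (Js[l := J]) \<inter> I = insert J (set Js \<inter> I)" using ex(2) J(1) by auto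
        then have "common (Js[l := J]) = Suc (common Js)" using J(2) by (simp add: common_def)
        then show False using Js(2)[OF ex(1)] by simp
      qed
      then obtain i where i: "i < length Is" "Is ! i = Js ! l" using Is(1) by (metis in_set_conv_nth)
      have "Js ! l \<in> set Js" using l bases_length[OF Js(1)] by simp
      then have "i \<noteq> k" using i k J(2) by metis
      then show ?thesis using row(2)[OF i(1) kd] i(2) pairing_y by auto
    qed simp
    then have "pairing y J = 0" unfolding pairing_cramer[OF Js(1), of y J] by (intro sum.neutral) auto
    then show False using row(1)[OF k(1)] k(2) pairing_y by simp
  qed
  moreover have "Js \<in> V_columns d n" "V_minor d W Js \<noteq> 0"
    using Js(1) bases_distinct[OF Js(1)] unfolding bases_def minor V_columns_def by blast+
  ultimately show ?thesis using W minors by blast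
qed

subsection \<open>Row spaces and Grassmannians\<close>

text \<open>Independence of the rows as a family, so repeated rows are excluded;
  \<open>lin_indpt\<close> applied to the set of rows would not notice them.\<close>

definition rows_independent :: "'a::field mat \<Rightarrow> bool" where
  "rows_independent A \<longleftrightarrow>
     (\<forall>y\<in>carrier_vec (dim_row A). A\<^sup>T *\<^sub>v y = 0\<^sub>v (dim_col A) \<longrightarrow> y = 0\<^sub>v (dim_row A))"

lemma rows_independentD:
  assumes "rows_independent A" "A \<in> carrier_mat m n" "y \<in> carrier_vec m" "A\<^sup>T *\<^sub>v y = 0\<^sub>v n"
  shows "y = 0\<^sub>v m"
  using assms unfolding rows_independent_def by auto

context vec_space begin

lemma row_space_iff:
  assumes "A \<in> carrier_mat m n"
  shows "w \<in> row_space A \<longleftrightarrow> (\<exists>y\<in>carrier_vec m. w = A\<^sup>T *\<^sub>v y)"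
  using assms unfolding row_space_eq[OF assms] by auto

lemma rows_independent_iff:
  assumes A: "A \<in> carrier_mat m n"
  shows "rows_independent A \<longleftrightarrow> distinct (rows A) \<and> lin_indpt (set (rows A))"
proof
  have AT: "A\<^sup>T \<in> carrier_mat n m" using A by simp
  {
    assume ind: "rows_independent A"
    have dist: "distinct (rows A)"
    proof (rule ccontr)
      assume "\<not> distinct (rows A)"
      then obtain i j where ij: "i < m" "j < m" "i \<noteq> j" "row A i = row A j"
        using A by (auto simp: distinct_conv_nth)
      \<comment> \<open>The difference of the unit vectors \<open>i\<close> and \<open>j\<close> is
        a relation between equal rows.\<close>
      define y where "y = vec m (\<lambda>k. if k = i then 1 else if k = j then - 1 else (0::'a))"
      have y: "y \<in> carrier_vec m" by (simp add: y_def)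
      have "A\<^sup>T *\<^sub>v y = 0\<^sub>v n"
      proof (rule eq_vecI)
        fix c assume c: "c < dim_vec (0\<^sub>v n)"
        have "A $$ (i, c) = A $$ (j, c)" using ij A c by (metis carrier_matD(1,2) index_row(1) index_zero_vec(2))
        have "(A\<^sup>T *\<^sub>v y) $ c = (\<Sum>k\<in>{0..<m}. A $$ (k, c) * y $ k)"
          using A c by (auto simp: scalar_prod_def y_def intro!: sum.cong)
        also have "\<dots> = (\<Sum>k\<in>{i, j}. A $$ (k, c) * y $ k)"
          using ij by (intro sum.mono_neutral_right) (auto simp: y_def)
        also have "\<dots> = 0" using ij \<open>A $$ (i, c) = A $$ (j, c)\<close> by (simp add: y_def)
        finally show "(A\<^sup>T *\<^sub>v y) $ c = 0\<^sub>v n $ c" using c by simp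
      qed (use A in auto)
      then have "y = 0\<^sub>v m" using rows_independentD[OF ind A y] by simp
      then have "y $ i = 0" using ij by simp
      then show False using ij by (simp add: y_def)
    qed
    have "lin_indpt (set (rows A))"
    proof
      assume "lin_dep (set (rows A))"
      then obtain y where "y \<in> carrier_vec m" "y \<noteq> 0\<^sub>v m" "A\<^sup>T *\<^sub>v y = 0\<^sub>v n"
        using lin_depE[OF AT] dist by (metis cols_transpose)
      then show False using rows_independentD[OF ind A] by blast
    qed
    with dist show "distinct (rows A) \<and> lin_indpt (set (rows A))" ..
  next
    assume "distinct (rows A) \<and> lin_indpt (set (rows A))"
    then show "rows_independent A"
      unfolding rows_independent_def using lin_depI[OF AT] A by (auto simp: cols_transpose)
  }
qed

lemma dim_row_space: "vectorspace.dim class_ring (vs (row_space A)) = rank (A\<^sup>T)"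
  unfolding rank_def row_space_def by (simp add: cols_transpose)

lemma row_space_in_Gr:
  assumes A: "A \<in> carrier_mat m n" and "rows_independent A"
  shows "row_space A \<in> Gr m n"
proof -
  have "rank (A\<^sup>T) = m"
    using lin_indpt_full_rank[of "A\<^sup>T" m] assms rows_independent_iff[OF A] by (simp add: cols_transpose)
  moreover have "subspace class_ring (row_space A) V"
    unfolding row_space_def using A by (intro span_is_subspace) (auto simp: rows_def)
  ultimately show ?thesis unfolding Gr_def using dim_row_space by blast
qed

text \<open>A basis of \<open>U\<close> is obtained as an independent subset of largest size, which
  exists because \<open>n\<close> bounds these sizes. Its elements become the rows.\<close>

lemma Gr_row_space:
  assumes "U \<in> Gr m n"
  shows "\<exists>A\<in>carrier_mat m n. row_space A = U \<and> rows_independent A"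
proof -
  have sub: "subspace class_ring U V" and dim: "vectorspace.dim class_ring (vs U) = m"
    using assms unfolding Gr_def by auto
  have mod: "submodule class_ring U V" using sub unfolding subspace_def by blast
  then have U: "U \<subseteq> carrier_vec n" unfolding submodule_def by simp
  define P where "P B \<longleftrightarrow> B \<subseteq> U \<and> lin_indpt B" for B
  have fin: "finite B" "card B < Suc n" if "P B" for B
  proof -
    have "B \<subseteq> carrier_vec n" "lin_indpt B" using that U unfolding P_def by auto
    then show "finite B" "card B < Suc n" using li_le_dim[OF fin_dim, of B] dim_is_n by auto
  qed
  have "P {}" unfolding P_def lin_dep_def by auto
  then have "\<exists>B. P B \<and> (\<forall>C. P C \<longrightarrow> card C \<le> card B)"
    using fin(2) by (intro ex_has_greatest_nat) auto
  then obtain B where B: "P B" "\<And>C. P C \<Longrightarrow> card C \<le> card B" by blast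
  then have BU: "B \<subseteq> U" "lin_indpt B" "finite B" using fin(1) by (auto simp: P_def)
  have BV: "B \<subseteq> carrier_vec n" using BU(1) U by blast
  have "span B = U"
  proof
    show "span B \<subseteq> U" using BU(1) mod by (rule span_is_subset)
    show "U \<subseteq> span B"
    proof
      fix w assume w: "w \<in> U"
      show "w \<in> span B"
      proof (rule ccontr)
        assume out: "w \<notin> span B"
        have "B \<subseteq> span B" using in_own_span[of B] BV by simp
        then have "w \<notin> B" using out by blast
        then have "lin_indpt (B \<union> {w})"
          using lin_dep_iff_in_span[of B w] BV BU(2) w U out by auto
        then have "P (insert w B)" unfolding P_def using w BU(1) by simp
        from B(2)[OF this] show False using \<open>w \<notin> B\<close> BU(3) by simp
      qed
    qed
  qed
  obtain bs where bs: "set bs = B" "distinct bs" using finite_distinct_list[OF BU(3)] by blast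
  define A where "A = mat_of_rows n bs"
  have rows: "rows A = bs" unfolding A_def using bs(1) BV by (intro rows_mat_of_rows) auto
  have A: "A \<in> carrier_mat (length bs) n" by (simp add: A_def)
  have RS: "row_space A = U" unfolding row_space_def rows bs(1) by fact
  have ind: "rows_independent A" unfolding rows_independent_iff[OF A] rows using bs BU(2) by simp
  have "length bs = m"
    using dim dim_row_space[of A] lin_indpt_full_rank[of "A\<^sup>T" "length bs"] A bs BU(2)
    by (simp add: RS cols_transpose rows)
  then show ?thesis using A RS ind by blast
qed

text \<open>A maximal independent subset of the set of rows has \<open>m\<close> elements, which
  forces the \<open>m\<close> rows to be distinct; full rank then gives independence.\<close>

lemma rows_independent_if_row_space_in_Gr:
  assumes A: "A \<in> carrier_mat m n" and Gr: "row_space A \<in> Gr m n"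
  shows "rows_independent A"
proof -
  have AT: "A\<^sup>T \<in> carrier_mat n m" and cols: "cols (A\<^sup>T) = rows A" using A by (auto simp: cols_transpose)
  have rank: "rank (A\<^sup>T) = m" using Gr dim_row_space[of A] unfolding Gr_def by simp
  have "lin_indpt {}" unfolding lin_dep_def by auto
  then have "\<exists>S. finite S \<and> maximal S (\<lambda>T. T \<subseteq> set (cols (A\<^sup>T)) \<and> lin_indpt T) \<and> {} \<subseteq> S"
    by (intro maximal_exists_superset[of "set (cols (A\<^sup>T))"]) auto
  then obtain S where S: "maximal S (\<lambda>T. T \<subseteq> set (cols (A\<^sup>T)) \<and> lin_indpt T)" by blast
  then have "card S \<le> card (set (rows A))" unfolding maximal_def cols by (intro card_mono) auto
  then have "m \<le> card (set (rows A))" using rank_card_indpt[OF AT S] rank by simp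
  moreover have "length (rows A) = m" using A by simp
  ultimately have "distinct (rows A)" using card_length[of "rows A"] by (intro card_distinct) simp
  then show ?thesis
    using full_rank_lin_indpt[OF AT rank] cols rows_independent_iff[OF A] by simp
qed

lemma row_space_subset_factor:
  assumes A: "A \<in> carrier_mat m n" and B: "B \<in> carrier_mat k n" and "row_space B \<subseteq> row_space A"
  shows "\<exists>Q\<in>carrier_mat k m. B = Q * A"
proof -
  have "\<exists>y\<in>carrier_vec m. row B i = A\<^sup>T *\<^sub>v y" if i: "i < k" for i
  proof -
    have "B\<^sup>T *\<^sub>v unit_vec k i = row B i"
      using B i by (intro eq_vecI) (auto simp: scalar_prod_right_unit)
    then have "row B i \<in> row_space B" unfolding row_space_iff[OF B] by (metis unit_vec_carrier)
    then show ?thesis using assms(3) row_space_iff[OF A] by blast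
  qed
  then obtain y where y: "\<And>i. i < k \<Longrightarrow> y i \<in> carrier_vec m \<and> row B i = A\<^sup>T *\<^sub>v y i" by metis
  define Q where "Q = mat k m (\<lambda>(i, j). y i $ j)"
  have "B = Q * A"
  proof (rule eq_matI)
    fix i c assume "i < dim_row (Q * A)" "c < dim_col (Q * A)"
    then have ic: "i < k" "c < n" using A by (auto simp: Q_def)
    have "B $$ (i, c) = (A\<^sup>T *\<^sub>v y i) $ c" using y[OF ic(1)] ic B by (metis carrier_matD index_row(1))
    also have "\<dots> = (Q * A) $$ (i, c)"
      using ic A y[OF ic(1)] by (auto simp: Q_def scalar_prod_def mult.commute intro!: sum.cong)
    finally show "B $$ (i, c) = (Q * A) $$ (i, c)" .
  qed (use A B in \<open>auto simp: Q_def\<close>)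
  then show ?thesis by (intro bexI[of _ Q]) (auto simp: Q_def)
qed

text \<open>Independent rows of \<open>W\<close> make multiplication by \<open>W\<^sup>T\<close>
  injective, so \<open>P\<close> and \<open>P * W\<close> have the same relations between their
  rows.\<close>

lemma rows_independent_mult:
  assumes P: "P \<in> carrier_mat k m" and W: "W \<in> carrier_mat m n" and "rows_independent W"
  shows "rows_independent (P * W) \<longleftrightarrow> rows_independent P"
proof -
  have PW: "P * W \<in> carrier_mat k n" using P W by simp
  have eq: "(P * W)\<^sup>T *\<^sub>v x = W\<^sup>T *\<^sub>v (P\<^sup>T *\<^sub>v x)" if "x \<in> carrier_vec k" for x
    using that P W by (simp add: transpose_mult[OF P W])
  have "(P * W)\<^sup>T *\<^sub>v x = 0\<^sub>v n \<longleftrightarrow> P\<^sup>T *\<^sub>v x = 0\<^sub>v m" if x: "x \<in> carrier_vec k" for x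
  proof
    assume "(P * W)\<^sup>T *\<^sub>v x = 0\<^sub>v n"
    moreover have "P\<^sup>T *\<^sub>v x \<in> carrier_vec m" using P x by simp
    ultimately show "P\<^sup>T *\<^sub>v x = 0\<^sub>v m" using rows_independentD[OF assms(3) W] eq[OF x] by simp
  next
    assume "P\<^sup>T *\<^sub>v x = 0\<^sub>v m"
    then show "(P * W)\<^sup>T *\<^sub>v x = 0\<^sub>v n" using eq[OF x] W by auto
  qed
  then show ?thesis using P PW W unfolding rows_independent_def by auto
qed

lemma row_space_mult_subset:
  assumes P: "P \<in> carrier_mat k m" and W: "W \<in> carrier_mat m n"
  shows "row_space (P * W) \<subseteq> row_space W"
proof
  have PW: "P * W \<in> carrier_mat k n" using P W by simp
  fix w assume "w \<in> row_space (P * W)"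
  then obtain x where x: "x \<in> carrier_vec k" "w = (P * W)\<^sup>T *\<^sub>v x" unfolding row_space_iff[OF PW] by blast
  then have "w = W\<^sup>T *\<^sub>v (P\<^sup>T *\<^sub>v x)" using P W by (simp add: transpose_mult[OF P W])
  moreover have "P\<^sup>T *\<^sub>v x \<in> carrier_vec m" using P x by simp
  ultimately show "w \<in> row_space W" unfolding row_space_iff[OF W] by blast
qed

end

section \<open>Pluecker coordinates of subspaces of a row space\<close>

lemma pick_lessThan:
  assumes "a < d"
  shows "pick {..<d} a = a"
proof -
  have "{x \<in> {..<d}. x < a} = {..<a}" using assms by auto
  then show ?thesis using pick_card_in_set[of a "{..<d}"] assms by simp
qed

text \<open>Let \<open>Q\<close> be \<open>P\<close> with the \<open>k\<close>-th unit row on top.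
  Since \<open>P\<close> kills \<open>y\<close>, the first column of \<open>Q * [y | W^J]\<close> is
  \<open>y $ k\<close> followed by zeros, and the remaining block is the submatrix of
  \<open>P * W\<close>. Comparing determinants gives the factor
  \<open>det Q / y $ k\<close>.\<close>

lemma det_submatrix_mult:
  fixes P W :: "'a::field mat"
  assumes P: "P \<in> carrier_mat d (d + 1)" "rows_independent P"
    and W: "W \<in> carrier_mat (d + 1) n"
    and y: "y \<in> carrier_vec (d + 1)" "P *\<^sub>v y = 0\<^sub>v d" "k < d + 1" "y $ k \<noteq> 0"
  shows "\<exists>c. c \<noteq> 0 \<and> (\<forall>J\<in>[{..<n}]\<^bsup>d\<^esup>.
    det (submatrix (P * W) {..<d} J) = c * det (augmented d W (\<lambda>i. y $ i) J))"
proof -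
  define Q where "Q = mat (d + 1) (d + 1) (\<lambda>(r, c). if r = 0 then if c = k then 1 else 0 else P $$ (r - 1, c))"
  have Q: "Q \<in> carrier_mat (d + 1) (d + 1)" by (simp only: Q_def mat_carrier)
  have Qy0: "(Q *\<^sub>v y) $ 0 = y $ k"
  proof -
    have "(Q *\<^sub>v y) $ 0 = (\<Sum>c\<in>{0..<d + 1}. (if c = k then 1 else 0) * y $ c)"
      using Q y(1) by (auto simp: Q_def scalar_prod_def simp del: sum.op_ivl_Suc intro!: sum.cong)
    also have "\<dots> = y $ k" using y(3) by (subst sum.remove[of _ k]) (auto intro!: sum.neutral)
    finally show ?thesis .
  qed
  have QySuc: "(Q *\<^sub>v y) $ Suc r = 0" if "r < d" for r
  proof -
    have "(Q *\<^sub>v y) $ Suc r = (P *\<^sub>v y) $ r"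
      using P(1) y(1) that by (auto simp: Q_def scalar_prod_def simp del: sum.op_ivl_Suc intro!: sum.cong)
    then show ?thesis using y(2) that by simp
  qed
  \<comment> \<open>A relation \<open>x\<close> between the rows of \<open>Q\<close>, paired with
    \<open>Q *\<^sub>v y\<close>, gives \<open>x $ 0 * y $ k = 0\<close>. The rest of
    \<open>x\<close> is then a relation between the rows of \<open>P\<close>.\<close>
  have "det Q \<noteq> 0"
  proof
    assume "det Q = 0"
    then have "det (Q\<^sup>T) = 0" using det_transpose[OF Q] by simp
    moreover have QT: "Q\<^sup>T \<in> carrier_mat (d + 1) (d + 1)" using Q by (simp only: transpose_carrier_mat)
    ultimately obtain x where x: "x \<in> carrier_vec (d + 1)" "x \<noteq> 0\<^sub>v (d + 1)" "Q\<^sup>T *\<^sub>v x = 0\<^sub>v (d + 1)"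
      using det_0_iff_vec_prod_zero[OF QT] by blast
    have "x \<bullet> (Q *\<^sub>v y) = (Q\<^sup>T *\<^sub>v x) \<bullet> y"
      using transpose_vec_mult_scalar[OF Q y(1) x(1)] by simp
    also have "\<dots> = 0" unfolding x(3) using y(1) by simp
    finally have "x \<bullet> (Q *\<^sub>v y) = 0" .
    moreover have "x \<bullet> (Q *\<^sub>v y) = x $ 0 * (Q *\<^sub>v y) $ 0 + (\<Sum>r<d. x $ Suc r * (Q *\<^sub>v y) $ Suc r)"
      using Q x(1) by (simp add: scalar_prod_def lessThan_atLeast0 sum.atLeast0_lessThan_Suc_shift del: sum.op_ivl_Suc index_mult_mat_vec)
    ultimately have x0: "x $ 0 = 0" using Qy0 QySuc y(4) by simp
    define x' where "x' = vec d (\<lambda>r. x $ Suc r)"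
    have x': "x' \<in> carrier_vec d" by (simp add: x'_def)
    have "P\<^sup>T *\<^sub>v x' = 0\<^sub>v (d + 1)"
    proof (rule eq_vecI)
      fix c assume "c < dim_vec (0\<^sub>v (d + 1))"
      then have c: "c < d + 1" by simp
      have "(Q\<^sup>T *\<^sub>v x) $ c = (\<Sum>r<Suc d. Q $$ (r, c) * x $ r)"
        using Q x(1) c by (auto simp: scalar_prod_def lessThan_atLeast0 simp del: sum.op_ivl_Suc intro!: sum.cong)
      also have "\<dots> = (\<Sum>r<d. Q $$ (Suc r, c) * x $ Suc r)"
        by (subst sum.lessThan_Suc_shift) (simp add: x0)
      also have "\<dots> = (P\<^sup>T *\<^sub>v x') $ c"
        using P(1) c by (auto simp: Q_def x'_def scalar_prod_def lessThan_atLeast0 intro!: sum.cong)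
      finally show "(P\<^sup>T *\<^sub>v x') $ c = 0\<^sub>v (d + 1) $ c" using x(3) by simp
    qed (use P(1) in auto)
    then have "x' = 0\<^sub>v d" using rows_independentD[OF P(2,1) x'] by simp
    then have xSuc: "x $ Suc r = 0" if "r < d" for r
      using that unfolding x'_def by (metis index_vec index_zero_vec(1))
    have "x = 0\<^sub>v (d + 1)"
    proof (rule eq_vecI)
      fix r assume "r < dim_vec (0\<^sub>v (d + 1))"
      then show "x $ r = 0\<^sub>v (d + 1) $ r" using x0 xSuc by (cases r) auto
    qed (use x in auto)
    then show False using x(2) by simp
  qed
  have "det (submatrix (P * W) {..<d} J) = det Q / y $ k * det (augmented d W (\<lambda>i. y $ i) J)"
    if J: "J \<in> [{..<n}]\<^bsup>d\<^esup>" for J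
  proof -
    define B where "B = augmented d W (\<lambda>i. y $ i) J"
    have J': "{j. j < n \<and> j \<in> J} = J" "card J = d" "J \<subseteq> {..<n}" using J by (auto simp: nsets_def)
    have B: "B \<in> carrier_mat (d + 1) (d + 1)" by (simp only: B_def augmented_carrier)
    have QB: "Q * B \<in> carrier_mat (d + 1) (d + 1)" using Q B by (rule mult_carrier_mat)
    have "col B 0 = y" using y(1) by (auto simp: B_def augmented_def)
    then have col0: "(Q * B) $$ (r, 0) = (Q *\<^sub>v y) $ r" if "r < d + 1" for r
      using that Q B by simp
    have "det (Q * B) = (\<Sum>r<Suc d. (Q * B) $$ (r, 0) * cofactor (Q * B) r 0)"
      using laplace_expansion_column[OF QB, of 0] by simp
    also have "\<dots> = y $ k * cofactor (Q * B) 0 0"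
      by (subst sum.lessThan_Suc_shift) (simp add: col0 Qy0 QySuc del: index_mult_mat)
    also have "cofactor (Q * B) 0 0 = det (mat_delete (Q * B) 0 0)" by (simp add: cofactor_def)
    also have "mat_delete (Q * B) 0 0 = submatrix (P * W) {..<d} J"
    proof (rule eq_matI)
      have rows: "{i. i < dim_row (P * W) \<and> i \<in> {..<d}} = {..<d}"
        and cols: "{j. j < dim_col (P * W) \<and> j \<in> J} = J"
        using P(1) W J'(1) by auto
      show "dim_row (mat_delete (Q * B) 0 0) = dim_row (submatrix (P * W) {..<d} J)"
        "dim_col (mat_delete (Q * B) 0 0) = dim_col (submatrix (P * W) {..<d} J)"
        unfolding dim_submatrix rows cols using QB J'(2) by auto
      fix i l assume "i < dim_row (submatrix (P * W) {..<d} J)" "l < dim_col (submatrix (P * W) {..<d} J)"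
      then have il: "i < d" "l < d" unfolding dim_submatrix rows cols using J'(2) by auto
      have "pick J l < n" using pick_in_set_le[of l J] il(2) J' by auto
      have "submatrix (P * W) {..<d} J $$ (i, l) = (P * W) $$ (i, pick J l)"
        using il J'(2) pick_lessThan[OF il(1)] submatrix_index[of i "P * W" "{..<d}" l J]
        unfolding rows cols by simp
      also have "\<dots> = (\<Sum>c\<in>{0..<Suc d}. P $$ (i, c) * W $$ (c, pick J l))"
        using il(1) \<open>pick J l < n\<close> P(1) W
        by (auto simp: scalar_prod_def simp del: sum.op_ivl_Suc intro!: sum.cong)
      also have "\<dots> = (Q * B) $$ (Suc i, Suc l)"
        using il Q B by (auto simp: Q_def B_def augmented_def scalar_prod_def simp del: sum.op_ivl_Suc intro!: sum.cong)
      also have "\<dots> = mat_delete (Q * B) 0 0 $$ (i, l)"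
        using il carrier_matD[OF Q] carrier_matD[OF B] by (simp add: mat_delete_def del: index_mult_mat(1))
      finally show "mat_delete (Q * B) 0 0 $$ (i, l) = submatrix (P * W) {..<d} J $$ (i, l)" by simp
    qed
    finally have "det Q * det B = y $ k * det (submatrix (P * W) {..<d} J)"
      using det_mult[OF Q B] by simp
    then show ?thesis using y(4) by (simp add: field_simps B_def)
  qed
  then show ?thesis using \<open>det Q \<noteq> 0\<close> y(4) by (intro exI[of _ "det Q / y $ k"]) auto
qed

text \<open>Padding \<open>P\<close> with a zero row makes it square and singular.\<close>

lemma exists_kernel_vector:
  fixes P :: "'a::field mat"
  assumes P: "P \<in> carrier_mat d (d + 1)"
  shows "\<exists>y\<in>carrier_vec (d + 1). y \<noteq> 0\<^sub>v (d + 1) \<and> P *\<^sub>v y = 0\<^sub>v d"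
proof -
  define S where "S = mat (d + 1) (d + 1) (\<lambda>(r, c). if r = 0 then 0 else P $$ (r - 1, c))"
  have S: "S \<in> carrier_mat (d + 1) (d + 1)" by (simp only: S_def mat_carrier)
  have "det S = 0" using laplace_expansion_row[OF S, of 0] by (simp add: S_def)
  then obtain y where y: "y \<in> carrier_vec (d + 1)" "y \<noteq> 0\<^sub>v (d + 1)" "S *\<^sub>v y = 0\<^sub>v (d + 1)"
    using det_0_iff_vec_prod_zero[OF S] by blast
  have "P *\<^sub>v y = 0\<^sub>v d"
  proof (rule eq_vecI)
    fix r assume "r < dim_vec (0\<^sub>v d)"
    then have r: "r < d" by simp
    have "(P *\<^sub>v y) $ r = (S *\<^sub>v y) $ Suc r"
      using P y(1) r by (auto simp: S_def scalar_prod_def simp del: sum.op_ivl_Suc intro!: sum.cong)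
    then show "(P *\<^sub>v y) $ r = 0\<^sub>v d $ r" using y(3) r by simp
  qed (use P in auto)
  then show ?thesis using y by blast
qed

text \<open>For each index \<open>c\<close> other than \<open>k\<close>, take the row
  \<open>e_c - (y_c / y_k) e_k\<close>. The function \<open>insert_index k\<close> enumerates these
  indices, and the unit entries away from column \<open>k\<close> show independence.\<close>

lemma exists_rows_independent_kernel:
  fixes y :: "'a::field vec"
  assumes y: "y \<in> carrier_vec (d + 1)" "k < d + 1" "y $ k \<noteq> 0"
  shows "\<exists>P\<in>carrier_mat d (d + 1). rows_independent P \<and> P *\<^sub>v y = 0\<^sub>v d"
proof -
  define P where "P = mat d (d + 1)
    (\<lambda>(r, c). if c = insert_index k r then 1 else if c = k then - (y $ insert_index k r) / y $ k else 0)"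
  have P: "P \<in> carrier_mat d (d + 1)" by (simp only: P_def mat_carrier)
  have ins: "insert_index k r < d + 1" "insert_index k r \<noteq> k" if "r < d" for r
    using that by (auto simp: insert_index_def)
  have inj: "insert_index k r = insert_index k r' \<longleftrightarrow> r = r'" for r r'
    by (auto simp: insert_index_def)
  have "P *\<^sub>v y = 0\<^sub>v d"
  proof (rule eq_vecI)
    fix r assume "r < dim_vec (0\<^sub>v d)"
    then have r: "r < d" by simp
    have "(P *\<^sub>v y) $ r = (\<Sum>c\<in>{0..<d + 1}. P $$ (r, c) * y $ c)"
      using P y(1) r by (auto simp: scalar_prod_def simp del: sum.op_ivl_Suc intro!: sum.cong)
    also have "\<dots> = (\<Sum>c\<in>{insert_index k r, k}. P $$ (r, c) * y $ c)"
      using ins[OF r] y(2) r by (intro sum.mono_neutral_right) (auto simp: P_def)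
    also have "\<dots> = 0" using ins[OF r] ins(2)[OF r, symmetric] y(2,3) r by (simp add: P_def)
    finally show "(P *\<^sub>v y) $ r = 0\<^sub>v d $ r" using r by simp
  qed (use P in auto)
  moreover have "rows_independent P"
    unfolding rows_independent_def
  proof (intro ballI impI)
    fix x assume "x \<in> carrier_vec (dim_row P)" and Px: "P\<^sup>T *\<^sub>v x = 0\<^sub>v (dim_col P)"
    then have x: "x \<in> carrier_vec d" using P by simp
    have "x $ r = 0" if r: "r < d" for r
    proof -
      have "(P\<^sup>T *\<^sub>v x) $ insert_index k r = (\<Sum>r'\<in>{0..<d}. P $$ (r', insert_index k r) * x $ r')"
        using P x ins[OF r] by (auto simp: scalar_prod_def intro!: sum.cong)
      also have "\<dots> = (\<Sum>r'\<in>{r}. P $$ (r', insert_index k r) * x $ r')"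
        using r ins[OF r] inj by (intro sum.mono_neutral_right) (auto simp: P_def)
      also have "\<dots> = x $ r" using r ins[OF r] by (simp add: P_def)
      finally show ?thesis using Px P ins[OF r] by simp
    qed
    then show "x = 0\<^sub>v (dim_row P)" using x P by (intro eq_vecI) auto
  qed
  ultimately show ?thesis using P by blast
qed

text \<open>A \<open>d\<close>-dimensional subspace of the row space of \<open>W\<close> is the row
  space of some \<open>P * W\<close>, and a kernel vector of \<open>P\<close> supplies the
  coefficients of its Pluecker vector. Conversely each nonzero \<open>y\<close> is a kernel vector
  of a suitable \<open>P\<close>. The scalars are absorbed into \<open>y\<close> or into the factor
  in \<open>pluecker\<close>.\<close>

lemma L_eq:
  fixes W :: "'a::field mat"
  assumes W: "W \<in> carrier_mat (d + 1) n" "rows_independent W"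
  shows "L d n (vec_space.row_space n W) =
    {(\<lambda>J\<in>[{..<n}]\<^bsup>d\<^esup>. \<Sum>i<d + 1. y i * V_entry d W i J) | y. \<exists>i<d + 1. y i \<noteq> 0}"
    (is "_ = ?R")
proof (intro equalityI subsetI)
  interpret vec_space "TYPE('a)" n .
  fix p assume "p \<in> L d n (row_space W)"
  then obtain U A c where U: "U \<in> Gr d n" "U \<subseteq> row_space W" and A: "A \<in> carrier_mat d n" "row_space A = U"
    and c: "c \<noteq> 0" and p: "p = (\<lambda>J\<in>[{..<n}]\<^bsup>d\<^esup>. c * det (submatrix A {..<d} J))"
    unfolding L_def pluecker_def by blast
  obtain P where P: "P \<in> carrier_mat d (d + 1)" "A = P * W"
    using row_space_subset_factor[OF W(1) A(1)] U(2) A(2) by blast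
  have "rows_independent A" using rows_independent_if_row_space_in_Gr[OF A(1)] U(1) A(2) by simp
  then have indP: "rows_independent P" using rows_independent_mult[OF P(1) W] P(2) by simp
  obtain y where y: "y \<in> carrier_vec (d + 1)" "y \<noteq> 0\<^sub>v (d + 1)" "P *\<^sub>v y = 0\<^sub>v d"
    using exists_kernel_vector[OF P(1)] by blast
  have "\<exists>k<d + 1. y $ k \<noteq> 0"
  proof (rule ccontr)
    assume "\<not> ?thesis"
    then have "y = 0\<^sub>v (d + 1)" using y(1) by (intro eq_vecI) auto
    then show False using y(2) by simp
  qed
  then obtain k where k: "k < d + 1" "y $ k \<noteq> 0" by blast
  obtain c' where c': "c' \<noteq> 0" "\<And>J. J \<in> [{..<n}]\<^bsup>d\<^esup> \<Longrightarrow>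
      det (submatrix A {..<d} J) = c' * det (augmented d W (\<lambda>i. y $ i) J)"
    using det_submatrix_mult[OF P(1) indP W(1) y(1,3) k] P(2) by blast
  define z where "z i = c * c' * y $ i" for i
  have "p J = (\<Sum>i<d + 1. z i * V_entry d W i J)" if J: "J \<in> [{..<n}]\<^bsup>d\<^esup>" for J
  proof -
    have "p J = c * c' * (\<Sum>i<d + 1. y $ i * V_entry d W i J)"
      unfolding sum_V_entry[OF W(1) J] using p c'(2)[OF J] J by simp
    then show ?thesis unfolding z_def by (simp only: sum_distrib_left mult.assoc)
  qed
  then have "p = (\<lambda>J\<in>[{..<n}]\<^bsup>d\<^esup>. \<Sum>i<d + 1. z i * V_entry d W i J)"
    using p by (auto simp: fun_eq_iff simp del: sum.lessThan_Suc)
  moreover have "z k \<noteq> 0" using c c'(1) k(2) by (simp add: z_def)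
  ultimately show "p \<in> ?R" using k(1) by blast
next
  interpret vec_space "TYPE('a)" n .
  fix p assume "p \<in> ?R"
  then obtain z k where p: "p = (\<lambda>J\<in>[{..<n}]\<^bsup>d\<^esup>. \<Sum>i<d + 1. z i * V_entry d W i J)"
    and k: "k < d + 1" "z k \<noteq> 0" by blast
  define y where "y = vec (d + 1) z"
  have y: "y \<in> carrier_vec (d + 1)" "y $ k \<noteq> 0" using k by (auto simp: y_def)
  obtain P where P: "P \<in> carrier_mat d (d + 1)" "rows_independent P" "P *\<^sub>v y = 0\<^sub>v d"
    using exists_rows_independent_kernel[OF y(1) k(1) y(2)] by blast
  obtain c where c: "c \<noteq> 0" "\<And>J. J \<in> [{..<n}]\<^bsup>d\<^esup> \<Longrightarrow>
      det (submatrix (P * W) {..<d} J) = c * det (augmented d W (\<lambda>i. y $ i) J)"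
    using det_submatrix_mult[OF P(1,2) W(1) y(1) P(3) k(1) y(2)] by blast
  have PW: "P * W \<in> carrier_mat d n" using P(1) W(1) by simp
  have "row_space (P * W) \<in> Gr d n"
    using row_space_in_Gr[OF PW] rows_independent_mult[OF P(1) W] P(2) by simp
  moreover have "row_space (P * W) \<subseteq> row_space W" by (rule row_space_mult_subset[OF P(1) W(1)])
  moreover have "p = (\<lambda>J\<in>[{..<n}]\<^bsup>d\<^esup>. inverse c * det (submatrix (P * W) {..<d} J))"
  proof -
    have "(\<Sum>i<d + 1. z i * V_entry d W i J) = inverse c * det (submatrix (P * W) {..<d} J)"
      if J: "J \<in> [{..<n}]\<^bsup>d\<^esup>" for J
    proof -
      have "(\<Sum>i<d + 1. z i * V_entry d W i J) = (\<Sum>i<d + 1. y $ i * V_entry d W i J)"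
        by (intro sum.cong) (auto simp: y_def)
      also have "\<dots> = inverse c * det (submatrix (P * W) {..<d} J)"
        unfolding sum_V_entry[OF W(1) J] c(2)[OF J] using c(1) by simp
      finally show ?thesis .
    qed
    then show ?thesis unfolding p by (intro restrict_ext)
  qed
  moreover have "inverse c \<noteq> 0" using c(1) by simp
  ultimately show "p \<in> L d n (row_space W)"
    unfolding L_def pluecker_def using PW by blast
qed

text \<open>The first \<open>m\<close> columns already form an invertible matrix.\<close>

lemma rows_independent_if_maximal_minors_nonzero:
  fixes W :: "'a::field mat"
  assumes W: "W \<in> carrier_mat m n" and "maximal_minors_nonzero m n W" "m \<le> n"
  shows "rows_independent W"
  unfolding rows_independent_def
proof (intro ballI impI)
  fix y assume "y \<in> carrier_vec (dim_row W)" and 0: "W\<^sup>T *\<^sub>v y = 0\<^sub>v (dim_col W)"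
  then have y: "y \<in> carrier_vec m" using W by simp
  define N where "N = mat m m (\<lambda>(i, l). W $$ (i, [0..<m] ! l))"
  have N: "N \<in> carrier_mat m m" "N\<^sup>T \<in> carrier_mat m m" by (simp_all add: N_def)
  have "det N \<noteq> 0" unfolding N_def
    using assms(2,3) unfolding maximal_minors_nonzero_def by (metis atLeastLessThan_upt distinct_upt
        diff_zero lessThan_atLeast0 lessThan_subset_iff length_upt)
  then have det: "det (N\<^sup>T) \<noteq> 0" using det_transpose[OF N(1)] by simp
  have "N\<^sup>T *\<^sub>v y = 0\<^sub>v m"
  proof (rule eq_vecI)
    fix l assume "l < dim_vec (0\<^sub>v m)"
    then have l: "l < m" by simp
    have "(N\<^sup>T *\<^sub>v y) $ l = (W\<^sup>T *\<^sub>v y) $ l"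
      using W y l assms(3) by (auto simp: N_def scalar_prod_def intro!: sum.cong)
    then show "(N\<^sup>T *\<^sub>v y) $ l = 0\<^sub>v m $ l" using 0 W l assms(3) by simp
  qed (simp add: N_def)
  then have "y = 0\<^sub>v m" using det_0_iff_vec_prod_zero[OF N(2)] det y by blast
  then show "y = 0\<^sub>v (dim_row W)" using W by simp
qed

subsection \<open>The tropicalization of \<open>L(X)\<close>\<close>

text \<open>It remains to identify the matroid of the columns of \<open>V\<close> for one matrix
  \<open>W\<close> representing \<open>X\<close>; equal values of the minors then make the fan
  theorem for vector configurations applicable.\<close>

lemma trop_L_eq_bergman_fan:
  fixes v :: "'a::alg_closed_field \<Rightarrow> real"
  assumes "nonarch_valuation v" and nontriv: "t \<noteq> 0" "v t \<noteq> 0" and "n \<ge> d + 1"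
    and generic: "generic d n X" and equal: "equal_valuations v d n X"
  shows "trop_L v d n X = bergman_fan ([{..<n}]\<^bsup>d\<^esup>) (dilworth_indep n (n - d))"
proof -
  let ?E = "[{..<n}]\<^bsup>d\<^esup>"
  have "X \<in> Gr (d + 1) n" using generic unfolding generic_def by blast
  then obtain W where W: "W \<in> carrier_mat (d + 1) n" "rows_independent W"
    and X: "vec_space.row_space n W = X"
    using vec_space.Gr_row_space by blast
  have repr: "W \<in> representing d n X" using W(1) X unfolding representing_def by simp
  interpret vector_configuration "d + 1" ?E "\<lambda>J i. V_entry d W i J"
    by unfold_locales (simp add: finite_imp_finite_nsets)
  have minor: "minor Js = V_minor d W Js" for Js unfolding minor_def V_minor_def ..
  have bases: "bases = {Js \<in> V_columns d n. V_minor d W Js \<noteq> 0}"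
    using minor_nonzero_distinct unfolding bases_def V_columns_def minor by auto
  have indep: "indep I \<longleftrightarrow> dilworth_indep n (n - d) I" for I
  proof
    assume "indep I"
    then obtain Js where "Js \<in> V_columns d n" "V_minor d W Js \<noteq> 0" "I \<subseteq> set Js"
      unfolding indep_def bases by blast
    then show "dilworth_indep n (n - d) I"
      using dilworth_indep_if_V_minor_nonzero[OF W(1) assms(4)] unfolding V_columns_def by blast
  next
    assume "dilworth_indep n (n - d) I"
    then obtain W' :: "'a mat" and Js where W': "W' \<in> carrier_mat (d + 1) n"
      "maximal_minors_nonzero (d + 1) n W'"
      and Js: "Js \<in> V_columns d n" "V_minor d W' Js \<noteq> 0" "I \<subseteq> set Js"
      using exists_V_minor_if_dilworth_indep[OF assms(1-4)] by blast
    \<comment> \<open>Genericity transfers the nonvanishing minor from the special matrix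
      \<open>W'\<close> to \<open>W\<close>.\<close>
    have "vec_space.row_space n W' \<in> Gr (d + 1) n"
      using vec_space.row_space_in_Gr[OF W'(1)]
        rows_independent_if_maximal_minors_nonzero[OF W' assms(4)] by blast
    moreover have "W' \<in> representing d n (vec_space.row_space n W')"
      using W'(1) unfolding representing_def by simp
    ultimately have "V_minor d W Js \<noteq> 0"
      using generic Js(1,2) repr unfolding generic_def by blast
    then show "indep I" using Js(1,3) unfolding indep_def bases by blast
  qed
  have "indep {}" unfolding indep dilworth_indep_def by simp
  then have "bases \<noteq> {}" unfolding indep_def by blast
  \<comment> \<open>At least one coordinate exists, also for \<open>d = 0\<close>, so a point with
    all coordinates nonzero has a nonzero coefficient vector.\<close>
  have "card {..<d} = d" "{..<d} \<subseteq> {..<n}" using assms(4) by auto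
  then have ne: "{..<d} \<in> ?E" unfolding nsets_def by simp
  have nonzero: "\<exists>i<d + 1. y i \<noteq> 0" if "\<forall>J\<in>?E. pairing y J \<noteq> 0" for y
  proof (rule ccontr)
    assume "\<not> ?thesis"
    then have "pairing y {..<d} = 0" unfolding pairing_def by (intro sum.neutral) auto
    then show False using that ne by blast
  qed
  have L: "L d n X = {(\<lambda>J\<in>?E. pairing y J) | y. \<exists>i<d + 1. y i \<noteq> 0}"
    unfolding X[symmetric] L_eq[OF W] pairing_def ..
  have "{(\<lambda>J\<in>?E. s - v (p J)) | p s. p \<in> L d n X \<and> (\<forall>J\<in>?E. p J \<noteq> 0)} =
    {(\<lambda>J\<in>?E. s - v (pairing y J)) | y s. \<forall>J\<in>?E. pairing y J \<noteq> 0}" (is "?A = ?B")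
  proof (intro equalityI subsetI)
    fix w assume "w \<in> ?A"
    then obtain y s where "\<forall>J\<in>?E. (\<lambda>J\<in>?E. pairing y J) J \<noteq> 0"
      and w: "w = (\<lambda>J\<in>?E. s - v ((\<lambda>J\<in>?E. pairing y J) J))"
      unfolding L by blast
    then have "\<forall>J\<in>?E. pairing y J \<noteq> 0" by simp
    moreover have "w = (\<lambda>J\<in>?E. s - v (pairing y J))" unfolding w by (intro restrict_ext) simp
    ultimately show "w \<in> ?B" by blast
  next
    fix w assume "w \<in> ?B"
    then obtain y s where y: "\<forall>J\<in>?E. pairing y J \<noteq> 0" and w: "w = (\<lambda>J\<in>?E. s - v (pairing y J))" by blast
    have "(\<lambda>J\<in>?E. pairing y J) \<in> L d n X" unfolding L using nonzero[OF y] by blast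
    moreover have "\<forall>J\<in>?E. (\<lambda>J\<in>?E. pairing y J) J \<noteq> 0" using y by simp
    moreover have "w = (\<lambda>J\<in>?E. s - v ((\<lambda>J\<in>?E. pairing y J) J))" unfolding w by (intro restrict_ext) simp
    ultimately show "w \<in> ?A" by blast
  qed
  then have "trop_L v d n X = powertop_real ?E closure_of ?B"
    unfolding trop_L_def trop_def by (rule arg_cong)
  also have "\<dots> = bergman_fan ?E indep"
  proof (rule closure_eq_bergman_fan[OF assms(1) \<open>bases \<noteq> {}\<close>])
    show "\<exists>x. x \<noteq> 0 \<and> \<bar>v x - r\<bar> < \<epsilon>" if "\<epsilon> > 0" for r \<epsilon>
      using alg_closed_value_group_dense[OF assms(1) nontriv that] .
    show "v (minor Js) = v (minor Ks)" if "Js \<in> bases" "Ks \<in> bases" for Js Ks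
      using equal repr that unfolding equal_valuations_def bases minor by blast
  qed
  also have "indep = dilworth_indep n (n - d)" using indep by blast
  finally show ?thesis .
qed

theorem corollary23:
  fixes v :: "'a::alg_closed_field \<Rightarrow> real"
    and d n :: nat
    and X :: "'a vec set"
    and \<X> :: "(nat \<Rightarrow> real) set"
  assumes "nonarch_valuation v"
    and "\<exists>x. x \<noteq> 0 \<and> v x \<noteq> 0"
    and "n \<ge> d + 1"
    and "X \<in> Gr (d + 1) n"
    and "generic d n X"
    and "equal_valuations v d n X"
    and "trop_space v n X = \<X>"
  shows "trop_L v d n X = L_trop v d n \<X> \<and>
         L_trop v d n \<X> = bergman_fan ([{..<n}]\<^bsup>d\<^esup>) (dilworth_indep n (n - d))"
proof -
  obtain t where t: "t \<noteq> 0" "v t \<noteq> 0" using assms(2) by blast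
  have fan: "trop_L v d n Y = bergman_fan ([{..<n}]\<^bsup>d\<^esup>) (dilworth_indep n (n - d))"
    if "generic d n Y" "equal_valuations v d n Y" for Y
    using trop_L_eq_bergman_fan[OF assms(1) t assms(3) that] .
  \<comment> \<open>\<open>X\<close> witnesses existence in the description defining
    \<open>L_trop\<close>, and uniqueness holds because the fan in \<open>fan\<close> does not
    depend on \<open>Y\<close>.\<close>
  have "L_trop v d n \<X> = trop_L v d n X"
    unfolding L_trop_def
    by (rule the_equality) (use assms(5-7) fan in \<open>blast, metis\<close>)
  then show ?thesis using fan[OF assms(5,6)] by simp
qed

end
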